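(* Let $s\ge 7$. There is a constant $c_s>0$ such that in the $P_s$-saturation game on $n$ vertices starting from the empty graph (whichever player starts), Max has a strategy ensuring that the game graph contains a vertex of degree at least $c_s n$; i.e. Max can achieve a vertex of degree $\Theta_s(n)$.
   Context: In the $P_s$-saturation game on $n$ vertices, Max and Mini alternately claim previously unclaimed edges of $K_n$ so that the graph of claimed edges never contains a path on $s$ vertices ($P_s$); the game ends when no further edge can be claimed. *)

theory Defs
  imports Complex_Main
begin

definition complete_edges :: "nat \<Rightarrow> nat set set" where
  "complete_edges n = {e. e \<subseteq> {..<n} \<and> card e = 2}"

definition vertex_degree :: "nat set set \<Rightarrow> nat \<Rightarrow> nat" where
  "vertex_degree E v = card {e \<in> E. v \<in> e}"

text \<open>\<open>P\<^sub>s\<close> has \<open>s\<close> vertices (hence \<open>s - 1\<close> edges), and it is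
  sought as a not necessarily induced subgraph.\<close>

definition contains_path :: "nat \<Rightarrow> nat set set \<Rightarrow> bool" where
  "contains_path s E \<longleftrightarrow>
     (\<exists>p. length p = s \<and> distinct p \<and> (\<forall>i. Suc i < s \<longrightarrow> {p ! i, p ! Suc i} \<in> E))"

definition legal_moves :: "nat \<Rightarrow> nat \<Rightarrow> nat set set \<Rightarrow> nat set set" where
  "legal_moves s n E = {e \<in> complete_edges n - E. \<not> contains_path s (insert e E)}"

text \<open>A history lists the claimed edges in the order in which they were claimed, starting from
  the empty graph; the current game graph is its set of entries.\<close>

definition history :: "nat \<Rightarrow> nat \<Rightarrow> nat set list \<Rightarrow> bool" where
  "history s n h \<longleftrightarrow> (\<forall>i < length h. h ! i \<in> legal_moves s n (set (take i h)))"

definition finished_play :: "nat \<Rightarrow> nat \<Rightarrow> nat set list \<Rightarrow> bool" where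
  "finished_play s n h \<longleftrightarrow> history s n h \<and> legal_moves s n (set h) = {}"

datatype player = Player_Max | Player_Mini

fun opponent :: "player \<Rightarrow> player" where
  "opponent Player_Max = Player_Mini"
| "opponent Player_Mini = Player_Max"

definition to_move :: "player \<Rightarrow> nat \<Rightarrow> player" where
  "to_move first k = (if even k then first else opponent first)"

text \<open>A strategy for Max sees the whole history and must return a legal edge whenever it is
  Max's turn and the game is not over; its other values are irrelevant. Without this requirement
  a strategy could win vacuously by admitting no finished play that follows it.\<close>

definition max_strategy ::
    "nat \<Rightarrow> nat \<Rightarrow> player \<Rightarrow> (nat set list \<Rightarrow> nat set) \<Rightarrow> bool" where
  "max_strategy s n first \<sigma> \<longleftrightarrow>
     (\<forall>h. history s n h \<and> legal_moves s n (set h) \<noteq> {} \<and>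
          to_move first (length h) = Player_Max
        \<longrightarrow> \<sigma> h \<in> legal_moves s n (set h))"

definition follows :: "player \<Rightarrow> (nat set list \<Rightarrow> nat set) \<Rightarrow> nat set list \<Rightarrow> bool" where
  "follows first \<sigma> h \<longleftrightarrow>
     (\<forall>i < length h. to_move first i = Player_Max \<longrightarrow> h ! i = \<sigma> (take i h))"

end

theory Submission
  imports Defs "HOL-Library.Disjoint_Sets"
begin

text \<open>
  If \<open>c\<close> has two neighbours in different components of \<open>G - c\<close>, then no path on \<open>s - 1\<close> vertices ends
  at \<open>c\<close>, as the neighbour it misses would prolong it; so \<open>c\<close> may be joined to an isolated vertex.
  After that \<open>c\<close> has neighbours in three components, and Mini's next edge merges at most two of
  them. So Max, to move at such a \<open>c\<close>, can go on for as long as isolated vertices last. In the same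
  way, \<open>c\<close> can absorb isolated edges if it has legs of two vertices in different components of
  \<open>G - c\<close>.

  While many isolated vertices remain, Mini must therefore answer each vertex Max attaches by
  closing the component again. This lets Max produce linearly many components \<open>K\<^sub>2\<close>, \<open>K\<^sub>3\<close> and
  \<open>K\<^sub>s\<^sub>-\<^sub>4\<close>, more than there are isolated vertices left afterwards. From then on Mini loses by joining
  two components with at least two vertices each: unless both are single edges, this separates two
  legs at once, and for two single edges Max attaches a \<open>K\<^sub>s\<^sub>-\<^sub>4\<close> to force this.
  Once the isolated vertices are used up, only pairs inside components, all of them smaller than \<open>s\<close>,
  can be claimed safely. Max fixes their parity by joining two triangles if necessary (possible since
  \<open>3 + 3 < s\<close>), and Mini is the first who has to join two components.
\<close>

section \<open>Paths, cliques and spanning cycles\<close>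

text \<open>A vertex with separated legs must survive a race: a round has two edges, each of which
  spoils at most two isolated cliques, so degree \<open>d\<close> takes a supply of
  \<open>4 * d\<close>. Building the stock costs at most a constant times \<open>s * s * d\<close>
  isolated vertices, hence \<open>d\<close> may be linear in \<open>n\<close>.

  The size s - 4 comes from the four vertices of two joined single edges. With the clique attached,
  the component has exactly s vertices, and the only replies of Mini that leave no vertex with
  separated legs would complete a path through all of them. The bound s >= 7 also gives this clique
  the three vertices that the legs inside it use.

  The obstacle in the late phase is that Mini can hang isolated vertices on a clique, and one edge
  of Max does not turn the result into a clique again. One edge does restore a spanning cycle. So
  parts are asked to have a spanning cycle (\<open>calm\<close>), later only enough legs
  (\<open>thick\<close>), while the cliques merely have to stay numerous.\<close>

definition is_path :: "'a set set \<Rightarrow> 'a list \<Rightarrow> bool" where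
  "is_path E p \<longleftrightarrow> distinct p \<and> successively (\<lambda>x y. {x, y} \<in> E) p"

text \<open>A union of components. Connectedness is not asked for, so that unions and differences of
  such sets are again of this kind.\<close>

definition detached :: "'a set set \<Rightarrow> 'a set \<Rightarrow> bool" where
  "detached E A \<longleftrightarrow> (\<forall>e\<in>E. e \<inter> A \<noteq> {} \<longrightarrow> e \<subseteq> A)"

definition clique :: "'a set set \<Rightarrow> 'a set \<Rightarrow> bool" where
  "clique E D \<longleftrightarrow> (\<forall>x\<in>D. \<forall>y\<in>D. x \<noteq> y \<longrightarrow> {x, y} \<in> E)"

definition delete_vertex :: "'a \<Rightarrow> 'a set set \<Rightarrow> 'a set set" where
  "delete_vertex c E = {e \<in> E. c \<notin> e}"

lemma contains_path_iff: "contains_path s E \<longleftrightarrow> (\<exists>p. length p = s \<and> is_path E p)"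
  unfolding contains_path_def is_path_def successively_conv_nth by auto

lemma is_path_append:
  "is_path E (p @ q) \<longleftrightarrow> is_path E p \<and> is_path E q \<and> set p \<inter> set q = {} \<and>
     (p = [] \<or> q = [] \<or> {last p, hd q} \<in> E)"
  unfolding is_path_def by (auto simp: successively_append_iff)

lemma is_path_Cons:
  "is_path E (x # p) \<longleftrightarrow> is_path E p \<and> x \<notin> set p \<and> (p = [] \<or> {x, hd p} \<in> E)"
  unfolding is_path_def by (auto simp: successively_Cons)

lemma is_path_Nil [simp]: "is_path E []"
  by (simp add: is_path_def)

lemma is_path_rev [simp]: "is_path E (rev p) \<longleftrightarrow> is_path E p"
  unfolding is_path_def by (simp add: insert_commute)

lemma is_path_mono: "is_path E p \<Longrightarrow> E \<subseteq> F \<Longrightarrow> is_path F p"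
  unfolding is_path_def by (auto elim: successively_mono)

lemma is_path_length: "is_path E p \<Longrightarrow> length p = card (set p)"
  by (simp add: is_path_def distinct_card)

lemma contains_path_if_long: "is_path E p \<Longrightarrow> s \<le> length p \<Longrightarrow> contains_path s E"
proof -
  assume p: "is_path E p" "s \<le> length p"
  have "is_path E (take s p @ drop s p)" using p(1) by simp
  then have "is_path E (take s p)" by (simp only: is_path_append)
  then show ?thesis using p(2) unfolding contains_path_iff by (intro exI[of _ "take s p"]) simp
qed

lemma detachedD: "detached E A \<Longrightarrow> {x, y} \<in> E \<Longrightarrow> x \<in> A \<longleftrightarrow> y \<in> A"
  unfolding detached_def by (drule (1) bspec) auto

lemma detached_Un: "detached E A \<Longrightarrow> detached E B \<Longrightarrow> detached E (A \<union> B)"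
  unfolding detached_def by blast

lemma detached_Diff: "detached E A \<Longrightarrow> detached E B \<Longrightarrow> detached E (A - B)"
  unfolding detached_def by blast

lemma detached_insert_iff:
  "detached (insert e E) A \<longleftrightarrow> (e \<inter> A \<noteq> {} \<longrightarrow> e \<subseteq> A) \<and> detached E A"
  unfolding detached_def by blast

lemma detached_mono: "detached F A \<Longrightarrow> E \<subseteq> F \<Longrightarrow> detached E A"
  unfolding detached_def by blast

lemma is_path_detached:
  "detached E A \<Longrightarrow> is_path E p \<Longrightarrow> set p \<inter> A \<noteq> {} \<Longrightarrow> set p \<subseteq> A"
proof (induction p)
  case (Cons x p)
  show ?case
  proof (cases "p = []")
    case False
    with Cons.prems(2) have edge: "{x, hd p} \<in> E" and path: "is_path E p"
      by (auto simp: is_path_Cons)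
    have iff: "x \<in> A \<longleftrightarrow> hd p \<in> A" by (rule detachedD[OF Cons.prems(1) edge])
    have hd: "hd p \<in> set p" using False by simp
    have "set p \<inter> A \<noteq> {}" using Cons.prems(3) iff hd by auto
    then have "set p \<subseteq> A" using Cons.IH[OF Cons.prems(1) path] by blast
    then show ?thesis using iff hd by auto
  qed (use Cons in auto)
qed simp

lemma clique_mono: "clique E D \<Longrightarrow> E \<subseteq> F \<Longrightarrow> clique F D"
  unfolding clique_def by blast

lemma clique_is_path: "clique E D \<Longrightarrow> distinct p \<Longrightarrow> set p \<subseteq> D \<Longrightarrow> is_path E p"
proof (induction p)
  case (Cons x p)
  then show ?case by (cases p) (auto simp: is_path_Cons clique_def)
qed simp

lemma is_path_new_edge:
  assumes "is_path (insert {a, b} E) p" "\<not> is_path E p"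
  shows "\<exists>u v. p = u @ a # b # v \<or> p = u @ b # a # v"
proof -
  obtain i where i: "Suc i < length p" "{p ! i, p ! Suc i} \<notin> E"
    "{p ! i, p ! Suc i} \<in> insert {a, b} E"
    using assms unfolding is_path_def successively_conv_nth by blast
  then have "{p ! i, p ! Suc i} = {a, b}" by blast
  moreover have "p = take i p @ p ! i # p ! Suc i # drop (Suc (Suc i)) p"
    using i(1) by (metis Cons_nth_drop_Suc Suc_lessD append_take_drop_id)
  ultimately show ?thesis by (metis doubleton_eq_iff)
qed

lemma is_path_delete_vertex:
  "is_path E p \<Longrightarrow> c \<notin> set p \<Longrightarrow> is_path (delete_vertex c E) p"
proof (induction p)
  case (Cons x p)
  then show ?case by (cases p) (auto simp: is_path_Cons delete_vertex_def)
qed simp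

lemma delete_vertex_subset: "delete_vertex c E \<subseteq> E"
  by (auto simp: delete_vertex_def)

lemma delete_vertex_insert:
  "delete_vertex c (insert e E) = (if c \<in> e then delete_vertex c E else insert e (delete_vertex c E))"
  by (auto simp: delete_vertex_def)

lemma detached_delete_vertex: "detached E A \<Longrightarrow> detached (delete_vertex c E) A"
  by (rule detached_mono[OF _ delete_vertex_subset])

text \<open>A path that meets \<open>A\<close> stays in it and is too short there; a path that
  avoids \<open>A\<close> does not use the new edge.\<close>

lemma no_path_insert_within:
  assumes "\<not> contains_path s E" "detached E A" "e \<subseteq> A" "finite A" "card A < s"
  shows "\<not> contains_path s (insert e E)"
proof
  assume "contains_path s (insert e E)"
  then obtain p where p: "length p = s" "is_path (insert e E) p"
    unfolding contains_path_iff by blast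
  have det: "detached (insert e E) A" using assms(2,3) by (auto simp: detached_insert_iff)
  show False
  proof (cases "set p \<inter> A = {}")
    case True
    have "is_path E p" using p(2) True
    proof (induction p)
      case (Cons x p)
      then show ?case using assms(3) by (cases p) (auto simp: is_path_Cons)
    qed simp
    then show False using assms(1) p(1) unfolding contains_path_iff by blast
  next
    case False
    then have "set p \<subseteq> A" using is_path_detached[OF det p(2)] by blast
    then have "length p \<le> card A" using assms(4) p(2) by (metis card_mono is_path_length)
    then show False using p(1) assms(5) by simp
  qed
qed

text \<open>A single edge \<open>{a, b}\<close> counts as a cycle \<open>[a, b]\<close>.\<close>
definition spanned_by_cycle :: "'a set set \<Rightarrow> 'a set \<Rightarrow> bool" where
  "spanned_by_cycle E D \<longleftrightarrow> (\<exists>p. set p = D \<and> 2 \<le> length p \<and> is_path E p \<and> {last p, hd p} \<in> E)"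

lemma spanned_by_cycle_mono: "spanned_by_cycle E D \<Longrightarrow> E \<subseteq> F \<Longrightarrow> spanned_by_cycle F D"
  unfolding spanned_by_cycle_def using is_path_mono[of E _ F] by blast

lemma spanned_by_cycle_rotate:
  assumes "spanned_by_cycle E D" "c \<in> D"
  obtains q where "set (c # q) = D" "q \<noteq> []" "is_path E (c # q)" "{last q, c} \<in> E"
proof -
  obtain p where p: "set p = D" "2 \<le> length p" "is_path E p" "{last p, hd p} \<in> E"
    using assms(1) unfolding spanned_by_cycle_def by blast
  obtain u v where uv: "p = u @ c # v" using p(1) assms(2) by (metis split_list)
  have "is_path E (c # (v @ u))" using p(3,4) unfolding uv
    by (cases "v = []"; cases "u = []") (auto simp: is_path_append is_path_Cons)
  moreover have "{last (v @ u), c} \<in> E" 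
  proof (cases "u = []")
    case True
    then show ?thesis using p(2,4) uv by (auto split: if_splits)
  next
    case False
    then show ?thesis using p(3) uv by (auto simp: is_path_append)
  qed
  moreover have "v @ u \<noteq> []" using p(2) uv by auto
  moreover have "set (c # (v @ u)) = D" using p(1) uv by auto
  ultimately show ?thesis using that by blast
qed

text \<open>The vertex \<open>w\<close> is inserted between \<open>c\<close> and its successor
  \<open>x\<close> on the cycle. This is how Max repairs a part after Mini has hung \<open>w\<close>
  on \<open>c\<close>. For a single edge the result is a triangle.\<close>

lemma spanned_by_cycle_insert_vertex:
  assumes "spanned_by_cycle E D" "c \<in> D" "w \<notin> D"
  obtains x where "x \<in> D" "x \<noteq> c" "spanned_by_cycle (insert {w, x} (insert {c, w} E)) (insert w D)"
    "{c, x} \<in> E"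
proof -
  obtain q where q: "set (c # q) = D" "q \<noteq> []" "is_path E (c # q)" "{last q, c} \<in> E"
    by (rule spanned_by_cycle_rotate[OF assms(1,2)])
  let ?x = "hd q" and ?F = "insert {w, hd q} (insert {c, w} E)"
  have "is_path ?F (c # w # q)" using q assms(3)
    by (auto simp: is_path_Cons intro: is_path_mono)
  then have "spanned_by_cycle ?F (insert w D)" unfolding spanned_by_cycle_def
    using q by (intro exI[of _ "c # w # q"]) auto
  moreover have "?x \<in> D" "?x \<noteq> c" "{c, ?x} \<in> E" using q by (auto simp: is_path_Cons)
  ultimately show ?thesis using that by blast
qed

lemma clique_spanned_by_cycle:
  assumes "clique E D" "finite D" "2 \<le> card D"
  shows "spanned_by_cycle E D"
proof -
  obtain p where p: "set p = D" "distinct p" using finite_distinct_list[OF assms(2)] by blast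
  then have len: "2 \<le> length p" using assms(3) by (simp add: distinct_card[symmetric])
  then have ne: "p \<noteq> []" by auto
  have "hd p \<noteq> last p" using len p(2) by (cases p) auto
  moreover have "hd p \<in> D" "last p \<in> D" using p(1) ne by auto
  ultimately have "{last p, hd p} \<in> E" using assms(1) unfolding clique_def by metis
  then show ?thesis unfolding spanned_by_cycle_def
    using p len clique_is_path[OF assms(1) p(2)] by blast
qed

lemma spanned_by_cycle_card2:
  assumes "spanned_by_cycle E D" "card D = 2"
  shows "clique E D"
proof -
  obtain p where p: "set p = D" "is_path E p"
    using assms(1) unfolding spanned_by_cycle_def by blast
  have "length p = 2" using is_path_length[OF p(2)] p(1) assms(2) by simp
  then obtain a b where "p = [a, b]" by (auto simp: length_Suc_conv numeral_2_eq_2)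
  then show ?thesis using p unfolding clique_def by (auto simp: is_path_Cons insert_commute)
qed

lemma spanned_by_cycle_card: "spanned_by_cycle E D \<Longrightarrow> 2 \<le> card D"
  unfolding spanned_by_cycle_def by (metis is_path_length)

definition leg :: "nat \<Rightarrow> nat set set \<Rightarrow> nat \<Rightarrow> nat list \<Rightarrow> bool" where
  "leg l E c p \<longleftrightarrow> length p = l \<and> is_path E (c # p)"

lemma leg_mono: "leg l E c p \<Longrightarrow> E \<subseteq> F \<Longrightarrow> leg l F c p"
  unfolding leg_def by (auto intro: is_path_mono)

lemma spanned_by_cycle_leg:
  assumes "spanned_by_cycle E D" "c \<in> D" "l < card D"
  obtains p where "leg l E c p" "set p \<subseteq> D - {c}"
proof -
  obtain q where q: "set (c # q) = D" "q \<noteq> []" "is_path E (c # q)" "{last q, c} \<in> E"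
    by (rule spanned_by_cycle_rotate[OF assms(1,2)])
  have "length (c # q) = card D" using is_path_length[OF q(3)] q(1) by simp
  then have len: "length (take l q) = l" using assms(3) by auto
  have "is_path E ((c # take l q) @ drop l q)" using q(3) by simp
  then have "is_path E (c # take l q)" by (simp only: is_path_append)
  moreover have "set (take l q) \<subseteq> D - {c}"
    using q(1,3) set_take_subset[of l q] by (auto simp: is_path_Cons)
  ultimately show ?thesis using that len unfolding leg_def by blast
qed

section \<open>Winning positions\<close>

text \<open>A position with a vertex of degree \<open>d\<close> counts as won whoever is to move, since degrees
  never decrease.\<close>
inductive winning :: "nat \<Rightarrow> nat \<Rightarrow> nat \<Rightarrow> player \<Rightarrow> nat set set \<Rightarrow> bool"
  for s n d where
  goal: "v < n \<Longrightarrow> d \<le> vertex_degree E v \<Longrightarrow> winning s n d p E"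
| max_move: "e \<in> legal_moves s n E \<Longrightarrow> winning s n d Player_Mini (insert e E) \<Longrightarrow>
    winning s n d Player_Max E"
| mini_move: "legal_moves s n E \<noteq> {} \<Longrightarrow>
    (\<And>e. e \<in> legal_moves s n E \<Longrightarrow> winning s n d Player_Max (insert e E)) \<Longrightarrow>
    winning s n d Player_Mini E"

lemma vertex_degree_mono: "finite F \<Longrightarrow> E \<subseteq> F \<Longrightarrow> vertex_degree E v \<le> vertex_degree F v"
  unfolding vertex_degree_def by (rule card_mono) auto

lemma winning_Max_step:
  assumes "winning s n d Player_Max E" "finite E" "legal_moves s n E \<noteq> {}"
  shows "\<exists>e\<in>legal_moves s n E. winning s n d Player_Mini (insert e E)"
  using assms(1)
proof cases
  case (goal v)
  then have "d \<le> vertex_degree (insert e E) v" for e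
    using vertex_degree_mono[of "insert e E" E v] assms(2) by fastforce
  then show ?thesis using assms(3) goal(1) winning.goal by blast
next
  case (max_move e)
  then show ?thesis by blast
qed

lemma winning_Mini_step:
  assumes "winning s n d Player_Mini E" "finite E" "e \<in> legal_moves s n E"
  shows "winning s n d Player_Max (insert e E)"
  using assms(1)
proof cases
  case (goal v)
  then have "d \<le> vertex_degree (insert e E) v"
    using vertex_degree_mono[of "insert e E" E v] assms(2) by fastforce
  then show ?thesis using goal(1) winning.goal by blast
next
  case mini_move
  then show ?thesis using assms(3) by blast
qed

section \<open>From winning positions to strategies\<close>

lemma opponent_to_move: "to_move first (Suc k) = opponent (to_move first k)"
  by (cases first) (auto simp: to_move_def)

lemma winning_strategy:
  assumes "winning s n d first {}"
  shows "\<exists>\<sigma>. max_strategy s n first \<sigma> \<and>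
           (\<forall>h. finished_play s n h \<and> follows first \<sigma> h \<longrightarrow> (\<exists>v<n. d \<le> vertex_degree (set h) v))"
proof -
  \<comment> \<open>A good edge is legal in every unfinished position and winning wherever some edge
    is. The first half makes the strategy total, also on histories in which Max has already left the
    winning positions.\<close>
  define good where "good E e \<longleftrightarrow> e \<in> legal_moves s n E \<and>
    ((\<exists>e'\<in>legal_moves s n E. winning s n d Player_Mini (insert e' E)) \<longrightarrow>
      winning s n d Player_Mini (insert e E))" for E e
  define \<sigma> where "\<sigma> h = (SOME e. good (set h) e)" for h
  have ex: "\<exists>e. good E e" if "legal_moves s n E \<noteq> {}" for E
    unfolding good_def using that by blast
  have good: "good (set h) (\<sigma> h)" if "legal_moves s n (set h) \<noteq> {}" for h
    unfolding \<sigma>_def using someI_ex[OF ex[OF that]] .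
  have "max_strategy s n first \<sigma>"
    unfolding max_strategy_def using good unfolding good_def by blast
  moreover have "\<exists>v<n. d \<le> vertex_degree (set h) v"
    if "finished_play s n h" "follows first \<sigma> h" for h
  proof -
    have "k \<le> length h \<Longrightarrow> winning s n d (to_move first k) (set (take k h))" for k
    proof (induction k)
      case 0
      then show ?case using assms by (simp add: to_move_def)
    next
      case (Suc k)
      then have k: "k < length h" and IH: "winning s n d (to_move first k) (set (take k h))"
        by auto
      have legal: "h ! k \<in> legal_moves s n (set (take k h))"
        using that(1) k unfolding finished_play_def history_def by blast
      have set: "set (take (Suc k) h) = insert (h ! k) (set (take k h))"
        using k by (simp add: take_Suc_conv_app_nth)
      show ?case
      proof (cases "to_move first k")
        case Player_Max
        have "h ! k = \<sigma> (take k h)" using that(2) k Player_Max unfolding follows_def by blast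
        moreover have "good (set (take k h)) (\<sigma> (take k h))" using good legal by blast
        moreover have "\<exists>e\<in>legal_moves s n (set (take k h)).
            winning s n d Player_Mini (insert e (set (take k h)))"
          using winning_Max_step[of s n d "set (take k h)"] IH legal Player_Max by auto
        ultimately show ?thesis using Player_Max set unfolding good_def opponent_to_move by simp
      next
        case Player_Mini
        then show ?thesis using winning_Mini_step[OF _ _ legal] IH set
          unfolding opponent_to_move by simp
      qed
    qed
    from this[of "length h"] have "winning s n d (to_move first (length h)) (set h)" by simp
    \<comment> \<open>In a finished position neither move rule can have produced
      \<open>winning\<close>, which leaves only the rule \<open>goal\<close>.\<close>
    then show ?thesis
      using that(1) unfolding finished_play_def by cases auto
  qed
  ultimately show ?thesis by blast
qed

section \<open>Valid positions and isolated cliques\<close>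

definition valid :: "nat \<Rightarrow> nat \<Rightarrow> nat set set \<Rightarrow> bool" where
  "valid s n E \<longleftrightarrow> E \<subseteq> complete_edges n \<and> \<not> contains_path s E"

lemma finite_complete_edges [simp]: "finite (complete_edges n)"
  unfolding complete_edges_def by (rule finite_subset[of _ "Pow {..<n}"]) auto

lemma valid_finite: "valid s n E \<Longrightarrow> finite E"
  unfolding valid_def by (meson finite_complete_edges finite_subset)

lemma legal_moves_iff:
  "valid s n E \<Longrightarrow> e \<in> legal_moves s n E \<longleftrightarrow> e \<notin> E \<and> valid s n (insert e E)"
  unfolding valid_def legal_moves_def by auto

lemma complete_edgesE:
  assumes "e \<in> complete_edges n"
  obtains a b where "e = {a, b}" "a \<noteq> b" "a < n" "b < n"
  using assms unfolding complete_edges_def by (auto simp: card_2_iff)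

lemma complete_edges_doubleton [simp]: "{a, b} \<in> complete_edges n \<longleftrightarrow> a \<noteq> b \<and> a < n \<and> b < n"
  unfolding complete_edges_def by (auto simp: card_insert_if)

lemma valid_edge: "valid s n E \<Longrightarrow> {a, b} \<in> E \<Longrightarrow> a \<noteq> b \<and> a < n \<and> b < n"
  unfolding valid_def using complete_edges_doubleton by blast

lemma valid_insert_within:
  assumes "valid s n E" "detached E A" "{a, b} \<subseteq> A" "A \<subseteq> {..<n}" "card A < s" "a \<noteq> b"
  shows "valid s n (insert {a, b} E)"
proof -
  have "finite A" using assms(4) finite_subset by blast
  then show ?thesis using assms no_path_insert_within[of s E A "{a, b}"] unfolding valid_def by auto
qed

lemma vertex_degree_insert:
  assumes "finite E" "e \<notin> E" "v \<in> e"
  shows "vertex_degree (insert e E) v = Suc (vertex_degree E v)"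
proof -
  have "{x \<in> insert e E. v \<in> x} = insert e {x \<in> E. v \<in> x}" using assms(3) by auto
  then show ?thesis unfolding vertex_degree_def using assms(1,2) by simp
qed

text \<open>For \<open>r = 1\<close> these are the isolated vertices and for \<open>r = 2\<close>
  the isolated edges, the two kinds of supply that a vertex with separated legs absorbs.\<close>

definition clique_components :: "nat \<Rightarrow> nat set set \<Rightarrow> nat \<Rightarrow> nat set set" where
  "clique_components n E r = {D. D \<subseteq> {..<n} \<and> card D = r \<and> detached E D \<and> clique E D}"

lemma finite_clique_components [simp]: "finite (clique_components n E r)"
  unfolding clique_components_def by (rule finite_subset[of _ "Pow {..<n}"]) auto

lemma clique_components_disjoint:
  assumes "C \<in> clique_components n E r" "D \<in> clique_components n E r" "x \<in> C" "x \<in> D"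
  shows "C = D"
proof -
  have C: "detached E C" "clique E C" and D: "detached E D" "clique E D"
    using assms(1,2) unfolding clique_components_def by auto
  have "y \<in> D" if "y \<in> C" for y
    using C(2) D(1) detachedD[of E D x y] assms(3,4) that unfolding clique_def by metis
  moreover have "y \<in> C" if "y \<in> D" for y
    using D(2) C(1) detachedD[of E C x y] assms(3,4) that unfolding clique_def by metis
  ultimately show ?thesis by blast
qed

text \<open>A new edge spoils only the cliques that contain one of its ends, and each end lies in at
  most one since they are disjoint. Two edges per round thus cost at most four, whence the factor in
  \<open>4 * d\<close>.\<close>

lemma card_clique_components_insert:
  "card (clique_components n E r) \<le> card (clique_components n (insert {a, b} E) r) + 2"
proof -
  let ?K = "clique_components n E r" and ?L = "clique_components n (insert {a, b} E) r"
  define S where "S x = {D \<in> ?K. x \<in> D}" for x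
  have S: "card (S x) \<le> 1" for x
  proof -
    have "finite (S x)" unfolding S_def by simp
    moreover have "C = D" if "C \<in> S x" "D \<in> S x" for C D
      using that clique_components_disjoint[of C n E r D x] unfolding S_def by simp
    ultimately show ?thesis by (metis One_nat_def card_le_Suc0_iff_eq)
  qed
  have "?K \<subseteq> ?L \<union> (S a \<union> S b)"
    unfolding S_def clique_components_def
    by (auto simp: detached_insert_iff intro: clique_mono)
  then have "card ?K \<le> card (?L \<union> (S a \<union> S b))"
    by (intro card_mono) (auto simp: S_def)
  also have "\<dots> \<le> card ?L + (card (S a) + card (S b))"
    by (meson card_Un_le order_trans add_left_mono)
  finally show ?thesis using S[of a] S[of b] by linarith
qed

section \<open>A vertex whose legs are separated\<close>

text \<open>\<open>X\<close> is a union of components of the graph without \<open>c\<close>;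
  containing one leg and missing the other, it expresses that the legs lie in different
  components.\<close>

definition split_legs :: "nat \<Rightarrow> nat set set \<Rightarrow> nat \<Rightarrow> bool" where
  "split_legs l E c \<longleftrightarrow> (\<exists>X p q. c \<notin> X \<and> detached (delete_vertex c E) X \<and>
     leg l E c p \<and> leg l E c q \<and> set p \<subseteq> X \<and> set q \<inter> X = {})"

text \<open>A long path ending at \<open>c\<close> cannot meet both legs, so it could already be prolonged.\<close>
lemma no_path_attach_clique:
  assumes no: "\<not> contains_path s E" and X: "detached (delete_vertex c E) X"
    and p: "leg l E c p" "set p \<subseteq> X" and q: "leg l E c q" "set q \<inter> X = {}"
    and Z: "detached E Z" "finite Z" "card Z = l" "c \<notin> Z" "z \<in> Z" and l: "1 \<le> l" "l + 1 < s"
  shows "\<not> contains_path s (insert {c, z} E)"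
proof
  let ?F = "insert {c, z} E"
  assume "contains_path s ?F"
  then obtain r where r: "length r = s" "is_path ?F r" unfolding contains_path_iff by blast
  have "\<not> is_path E r" using no r(1) unfolding contains_path_iff by blast
  then obtain u v where "r = u @ c # z # v \<or> r = u @ z # c # v"
    using is_path_new_edge[OF r(2)] by blast
  then obtain u v where "length (u @ z # c # v) = s" "is_path ?F (u @ z # c # v)"
  proof
    assume "r = u @ c # z # v"
    then have "rev r = rev v @ z # c # rev u" by simp
    then show thesis using that[of "rev v" "rev u"] r is_path_rev[of ?F r] length_rev[of r] by metis
  qed (use that r in blast)
  then have len: "length u + length v + 2 = s" and path: "is_path ?F ((u @ [z]) @ c # v)" by auto
  have uz: "is_path ?F (u @ [z])" and cv: "is_path ?F (c # v)"
    and dis: "set (u @ [z]) \<inter> set (c # v) = {}"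
    using path unfolding is_path_append[of _ "u @ [z]"] by blast+
  have "is_path (delete_vertex c ?F) (u @ [z])"
    by (rule is_path_delete_vertex[OF uz]) (use dis in auto)
  then have uz': "is_path E (u @ [z])"
    by (rule is_path_mono) (auto simp: delete_vertex_def)
  have "set (u @ [z]) \<subseteq> Z" by (rule is_path_detached[OF Z(1) uz']) (use Z(5) in auto)
  then have "card (set (u @ [z])) \<le> l" using Z(2,3) card_mono by blast
  then have lu: "length u + 1 \<le> l" using is_path_length[OF uz'] by simp
  have "is_path (delete_vertex z ?F) (c # v)"
    by (rule is_path_delete_vertex[OF cv]) (use dis in auto)
  then have cv': "is_path E (c # v)"
    by (rule is_path_mono) (auto simp: delete_vertex_def)
  then have "is_path (delete_vertex c E) v"
    by (auto simp: is_path_Cons intro: is_path_delete_vertex)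
  then have "set v \<inter> X = {} \<or> set v \<subseteq> X" using is_path_detached[OF X] by blast
  \<comment> \<open>Since \<open>v\<close> lies entirely inside or entirely outside
    \<open>X\<close>, one of the two legs avoids it. This leg has \<open>l\<close> vertices and
    replaces \<open>u @ [z]\<close>, which has at most \<open>l\<close>, so the path does not get
    shorter.\<close>
  then obtain w where w: "leg l E c w" "set w \<inter> set v = {}" using p q by blast
  have "length w = l" "is_path E (c # w)" using w(1) unfolding leg_def by auto
  moreover from this have "w \<noteq> []" using l(1) by auto
  ultimately have "is_path E (rev w @ c # v)" using cv' w(2)
    by (auto simp: is_path_append[of _ "rev w"] is_path_Cons[of _ c w] last_rev insert_commute)
  then have "contains_path s E"
    by (rule contains_path_if_long) (use len lu \<open>length w = l\<close> in simp)
  then show False using no by blast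
qed

text \<open>\<open>p\<close>, \<open>q\<close>, \<open>w\<close> lie in three different components after deletion of \<open>c\<close>, and one new edge
  joins at most two of them.\<close>
lemma split_legs_persists:
  assumes "c \<notin> X" "detached (delete_vertex c E) X" "leg l E c p" "leg l E c q"
    "set p \<subseteq> X" "set q \<inter> X = {}"
    and "c \<notin> Z" "detached (delete_vertex c E) Z" "leg l E c w" "set w \<subseteq> Z"
    and "X \<inter> Z = {}" "set q \<inter> Z = {}"
  shows "split_legs l (insert {a, b} E) c"
proof -
  let ?F = "insert {a, b} E"
  have legs: "leg l ?F c p" "leg l ?F c q" "leg l ?F c w"
    using assms(3,4,9) leg_mono[of l E c _ ?F] by auto
  have det: "detached (delete_vertex c ?F) Y \<longleftrightarrow>
      (c \<in> {a, b} \<or> (a \<in> Y \<longleftrightarrow> b \<in> Y)) \<and> detached (delete_vertex c E) Y" if "c \<notin> Y" 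
      "detached (delete_vertex c E) Y" for Y
    using that by (auto simp: delete_vertex_insert detached_insert_iff)
  have XZ: "detached (delete_vertex c E) (X \<union> Z)" using assms(2,8) by (rule detached_Un)
  \<comment> \<open>As \<open>X\<close> and \<open>Z\<close> are disjoint, an edge that crosses the
    borders of both runs from one to the other, and then it does not cross the border of
    \<open>X \<union> Z\<close>.\<close>
  consider "c \<in> {a, b} \<or> (a \<in> X \<longleftrightarrow> b \<in> X)" | "c \<in> {a, b} \<or> (a \<in> Z \<longleftrightarrow> b \<in> Z)"
    | "a \<in> X \<union> Z \<longleftrightarrow> b \<in> X \<union> Z"
    using assms(11) by blast
  then show ?thesis
  proof cases
    case 1
    then have "detached (delete_vertex c ?F) X" using det assms(1,2) by blast
    then show ?thesis using assms(1,5,6) legs unfolding split_legs_def by blast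
  next
    case 2
    then have "detached (delete_vertex c ?F) Z" using det assms(7,8) by blast
    moreover have "set p \<inter> Z = {}" using assms(5,11) by blast
    ultimately show ?thesis using assms(7,10) legs unfolding split_legs_def by blast
  next
    case 3
    then have "detached (delete_vertex c ?F) (X \<union> Z)" using det[of "X \<union> Z"] XZ assms(1,7) by blast
    moreover have "c \<notin> X \<union> Z" "set p \<subseteq> X \<union> Z" "set q \<inter> (X \<union> Z) = {}"
      using assms(1,5,6,7,12) by auto
    ultimately show ?thesis using legs unfolding split_legs_def by blast
  qed
qed

text \<open>The attached clique becomes a third leg of \<open>c\<close> in a third part, so whatever
  edge comes next, two legs are still separated. Hence the quantification over \<open>a\<close> and
  \<open>b\<close>.\<close>

lemma split_legs_attach:
  assumes v: "valid s n E" and sp: "split_legs l E c" and l: "1 \<le> l" "l + 1 < s"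
    and Z: "Z \<in> clique_components n E l" and c: "c < n"
  obtains z where "{c, z} \<in> legal_moves s n E"
    "\<And>a b. split_legs l (insert {a, b} (insert {c, z} E)) c"
proof -
  obtain X p q where X: "c \<notin> X" "detached (delete_vertex c E) X" and p: "leg l E c p" "set p \<subseteq> X"
    and q: "leg l E c q" "set q \<inter> X = {}"
    using sp unfolding split_legs_def by blast
  have Z': "Z \<subseteq> {..<n}" "card Z = l" "detached E Z" "clique E Z"
    using Z unfolding clique_components_def by auto
  then have fin: "finite Z" using finite_subset by blast
  have pq: "is_path E (c # p)" "is_path E (c # q)" "length p = l" "length q = l"
    using p q unfolding leg_def by auto
  have disj: "set p \<inter> set q = {}" using p q by blast
  \<comment> \<open>Otherwise both legs would lie in \<open>Z\<close>, which has room for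
    \<open>l\<close> vertices and not for \<open>2 * l\<close>.\<close>
  have cZ: "c \<notin> Z"
  proof
    assume "c \<in> Z"
    then have "set (c # p) \<subseteq> Z" "set (c # q) \<subseteq> Z"
      using is_path_detached[OF Z'(3) pq(1)] is_path_detached[OF Z'(3) pq(2)] by auto
    then have "card (set p \<union> set q) \<le> l" using fin Z'(2) card_mono[of Z "set p \<union> set q"] by auto
    moreover have "card (set p) = l" "card (set q) = l"
      using pq by (auto simp: is_path_def distinct_card)
    ultimately show False using card_Un_disjoint[OF _ _ disj] l(1) by simp
  qed
  have pZ: "set p \<inter> Z = {}" "set q \<inter> Z = {}"
    using is_path_detached[OF Z'(3) pq(1)] is_path_detached[OF Z'(3) pq(2)] cZ by auto
  obtain w where w: "set w = Z" "distinct w" using finite_distinct_list[OF fin] by blast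
  then have "length w = l" using Z'(2) distinct_card by metis
  then obtain z w' where zw: "w = z # w'" using l(1) by (cases w) auto
  then have z: "z \<in> Z" using w by auto
  have notin: "{c, z} \<notin> E" using detachedD[OF Z'(3)] cZ z by blast
  have "\<not> contains_path s (insert {c, z} E)"
    by (rule no_path_attach_clique[OF _ X(2) p q Z'(3) fin Z'(2) cZ z l])
      (use v in \<open>simp add: valid_def\<close>)
  moreover have "z < n" "z \<noteq> c" using z Z'(1) cZ by auto
  ultimately have legal: "{c, z} \<in> legal_moves s n E"
    using v c notin unfolding legal_moves_def valid_def by auto
  let ?F = "insert {c, z} E"
  have mono: "leg l ?F c p" "leg l ?F c q" using p q leg_mono[of l E c _ ?F] by auto
  have "is_path ?F w"
    using clique_is_path[OF Z'(4) w(2)] w(1) is_path_mono[of E w ?F] by auto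
  then have wleg: "leg l ?F c w"
    unfolding leg_def using \<open>length w = l\<close> zw w cZ by (auto simp: is_path_Cons[of _ c])
  have del: "delete_vertex c ?F = delete_vertex c E" by (simp add: delete_vertex_insert)
  \<comment> \<open>\<open>X\<close> may contain \<open>Z\<close>. Passing to \<open>X - Z\<close>
    makes the parts disjoint and keeps \<open>p\<close>, which misses \<open>Z\<close>.\<close>
  have "split_legs l (insert {a, b} ?F) c" for a b
  proof (rule split_legs_persists[of c "X - Z" ?F l p q Z w])
    show "detached (delete_vertex c ?F) (X - Z)" "detached (delete_vertex c ?F) Z"
      unfolding del using X(2) Z'(3) by (auto intro: detached_Diff detached_delete_vertex)
  qed (use X p q pZ cZ mono wleg w in auto)
  then show ?thesis using that legal by blast
qed

lemma split_legs_wins_bounded: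
  assumes "valid s n E" "split_legs l E c" "1 \<le> l" "l + 1 < s" "c < n"
    and "d \<le> vertex_degree E c + k" "4 * k \<le> card (clique_components n E l)"
  shows "winning s n d Player_Max E"
  using assms
proof (induction k arbitrary: E)
  case 0
  then show ?case using winning.goal[of c n d E] by simp
next
  case (Suc k)
  then have "clique_components n E l \<noteq> {}" by auto
  then obtain Z where Z: "Z \<in> clique_components n E l" by blast
  obtain z where z: "{c, z} \<in> legal_moves s n E"
    "\<And>a b. split_legs l (insert {a, b} (insert {c, z} E)) c"
    using split_legs_attach[OF Suc.prems(1-4) Z Suc.prems(5)] by blast
  let ?F = "insert {c, z} E"
  have F: "{c, z} \<notin> E" "valid s n ?F" using z(1) legal_moves_iff[OF Suc.prems(1)] by auto
  have deg: "vertex_degree ?F c = Suc (vertex_degree E c)"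
    by (rule vertex_degree_insert) (use F valid_finite Suc.prems(1) in auto)
  have card: "card (clique_components n E l) \<le> card (clique_components n ?F l) + 2"
    by (rule card_clique_components_insert)
  have "winning s n d Player_Mini ?F"
  proof (cases "k = 0")
    case True
    then have "d \<le> vertex_degree ?F c" using Suc.prems(6) deg by simp
    then show ?thesis using winning.goal[of c n d ?F] Suc.prems(5) by blast
  next
    case False
    show ?thesis
    proof (rule winning.mini_move)
      have "clique_components n ?F l \<noteq> {}" using card Suc.prems(7) False by auto
      \<comment> \<open>Inserting \<open>{c, z}\<close> once more changes nothing, so the legs are
        separated in \<open>?F\<close> as well; the next attachment at \<open>c\<close> is then a
        legal move for Mini, and the game is not over.\<close>
      moreover have "split_legs l ?F c" using z(2)[of c z] by simp
      ultimately show "legal_moves s n ?F \<noteq> {}"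
        using split_legs_attach[OF F(2) _ Suc.prems(3,4) _ Suc.prems(5)] by blast
    next
      fix e assume e: "e \<in> legal_moves s n ?F"
      then have v: "valid s n (insert e ?F)" using legal_moves_iff[OF F(2)] by blast
      obtain a b where ab: "e = {a, b}" using e complete_edgesE unfolding legal_moves_def by blast
      have "vertex_degree ?F c \<le> vertex_degree (insert e ?F) c"
        by (rule vertex_degree_mono) (use valid_finite[OF v] in auto)
      then have degs: "d \<le> vertex_degree (insert e ?F) c + k" using deg Suc.prems(6) by simp
      have "card (clique_components n ?F l) \<le> card (clique_components n (insert e ?F) l) + 2"
        unfolding ab by (rule card_clique_components_insert)
      then have many: "4 * k \<le> card (clique_components n (insert e ?F) l)"
        using card Suc.prems(7) by simp
      show "winning s n d Player_Max (insert e ?F)"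
        by (rule Suc.IH[OF v _ Suc.prems(3-5) degs many]) (simp add: ab z(2))
    qed
  qed
  then show ?case using z(1) winning.max_move by blast
qed

lemma split_legs_wins:
  assumes "valid s n E" "split_legs l E c" "1 \<le> l" "l + 1 < s" "c < n"
    and "4 * d \<le> card (clique_components n E l)"
  shows "winning s n d Player_Max E"
  using split_legs_wins_bounded[OF assms(1-5), of d d] assms(6) by simp

text \<open>The joining edge itself contributes one vertex to the leg through \<open>b\<close>, so
  \<open>l - 1\<close> further vertices suffice in \<open>B\<close>. Since the only edge that leaves
  \<open>B\<close> is the new one at \<open>a\<close>, the set \<open>B\<close> separates the
  legs.\<close>

lemma split_legs_join:
  assumes "detached E B" "a \<notin> B" "b \<in> B" "1 \<le> l"
    and "leg l E a q" "set q \<inter> B = {}" "leg (l - 1) E b p" "set p \<subseteq> B"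
  shows "split_legs l (insert {a, b} E) a"
proof -
  let ?F = "insert {a, b} E"
  have "is_path ?F (b # p)" using assms(7) is_path_mono[of E "b # p" ?F] by (auto simp: leg_def)
  then have "leg l ?F a (b # p)"
    using assms unfolding leg_def by (auto simp: is_path_Cons[of _ a])
  moreover have "leg l ?F a q" using assms(5) leg_mono[of l E a q ?F] by auto
  moreover have "detached (delete_vertex a ?F) B"
    using assms(1) by (simp add: delete_vertex_insert detached_delete_vertex)
  ultimately show ?thesis unfolding split_legs_def using assms
    by (intro exI[of _ B] exI[of _ "b # p"] exI[of _ q]) auto
qed

text \<open>Two isolated edges can always be joined, as four vertices are too few for the forbidden
  path. This guarantees that Mini has a move, hence that the game does not end early.\<close>

lemma legal_moves_nonempty:
  assumes "valid s n E" "4 < s" "2 \<le> card (clique_components n E 2)"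
  shows "legal_moves s n E \<noteq> {}"
proof -
  have "\<not> card (clique_components n E 2) \<le> Suc 0" using assms(3) by simp
  then obtain C D where CD: "C \<in> clique_components n E 2" "D \<in> clique_components n E 2" "C \<noteq> D"
    using card_le_Suc0_iff_eq[of "clique_components n E 2"] by auto
  then have C: "C \<subseteq> {..<n}" "card C = 2" "detached E C" and D: "D \<subseteq> {..<n}" "card D = 2" "detached E D"
    unfolding clique_components_def by auto
  have "C \<noteq> {}" "D \<noteq> {}" using C(2) D(2) by auto
  then obtain c d where cd: "c \<in> C" "d \<in> D" by blast
  have "c \<notin> D" "d \<notin> C" using clique_components_disjoint[OF CD(1,2)] CD(3) cd by blast+
  then have "{c, d} \<notin> E" using detachedD[OF C(3)] cd by blast
  moreover have "card (C \<union> D) < s" using card_Un_le[of C D] C(2) D(2) assms(2) by simp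
  then have "valid s n (insert {c, d} E)"
    by (intro valid_insert_within[OF assms(1) detached_Un[OF C(3) D(3)]])
      (use cd C D \<open>c \<notin> D\<close> in auto)
  ultimately show ?thesis using legal_moves_iff[OF assms(1)] by blast
qed

text \<open>Max joins \<open>a\<close> to some \<open>g \<in> G\<close>. An edge from \<open>{b, b'}\<close> to a vertex of \<open>G\<close> other than \<open>g\<close> would
  create a path on \<open>s\<close> vertices, an edge to \<open>g\<close> leaves \<open>g\<close> with separated legs, and any other answer
  leaves \<open>a\<close> with separated legs.\<close>
lemma two_edges_joined_wins:
  assumes v: "valid s n E" and s: "7 \<le> s"
    and edges: "{a, a'} \<in> E" "{b, b'} \<in> E" "{a, b} \<in> E"
    and ne: "distinct [a, a', b, b']"
    and P: "detached E {a, a', b, b'}"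
    and det: "detached (delete_vertex a E) {a'}" "detached (delete_vertex a E) {b, b'}"
    and G: "G \<in> clique_components n E (s - 4)" "a \<notin> G" 
    and fodder: "4 * d + 6 \<le> card (clique_components n E 2)"
  shows "winning s n d Player_Max E"
proof -
  have G': "G \<subseteq> {..<n}" "card G = s - 4" "detached E G" "clique E G"
    using G(1) unfolding clique_components_def by auto
  have finG: "finite G" using G'(1) finite_subset by blast
  have other: "a' \<notin> G" "b \<notin> G" "b' \<notin> G"
    using detachedD[OF G'(3)] edges G(2) by blast+
  obtain xs where xs: "set xs = G" "distinct xs" using finite_distinct_list[OF finG] by blast
  have "length xs = s - 4" using xs G'(2) distinct_card by metis
  \<comment> \<open>Here \<open>7 \<le> s\<close> supplies three vertices of \<open>G\<close>: after
    \<open>g\<close> is joined to \<open>a\<close>, the vertices \<open>g1\<close> and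
    \<open>g2\<close> serve as a leg of \<open>g\<close> inside \<open>G\<close>.\<close>
  then obtain n3 where "length xs = Suc (Suc (Suc n3))" using s by (intro that[of "s - 7"]) simp
  then obtain g g1 g2 xs' where "xs = g # g1 # g2 # xs'" by (auto simp: length_Suc_conv)
  then have g: "g \<in> G" "g1 \<in> G" "g2 \<in> G" "distinct [g, g1, g2]" using xs by auto
  let ?F = "insert {a, g} E"
  have lt: "a < n" "a' < n" "b < n" "b' < n" using edges valid_edge[OF v] by auto
  have gn: "g < n" using g(1) G'(1) by auto
  have notin: "{a, g} \<notin> E" using detachedD[OF G'(3)] g(1) G(2) by blast
  have delF: "delete_vertex a ?F = delete_vertex a E" by (simp add: delete_vertex_insert)
  have detG: "detached (delete_vertex a E) G" using G'(3) by (rule detached_delete_vertex)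
  \<comment> \<open>The new component has 4 + (s - 4) vertices, so a forbidden path would visit all
    of it. Deleting \<open>a\<close> leaves the three parts \<open>{a'}\<close>,
    \<open>{b, b'}\<close> and \<open>G\<close>, but cuts a path into at most two pieces.\<close>
  have noF: "\<not> contains_path s ?F"
  proof
    assume "contains_path s ?F"
    then obtain r where r: "length r = s" "is_path ?F r" unfolding contains_path_iff by blast
    have "\<not> is_path E r" using v r(1) unfolding valid_def contains_path_iff by blast
    then have ar: "a \<in> set r" using is_path_new_edge[OF r(2)] by auto
    let ?A = "{a, a', b, b'} \<union> G"
    have fin: "finite ?A" using finG by simp
    have "card {a, a', b, b'} = 4" using ne by simp
    then have card: "card ?A \<le> s" using card_Un_le[of "{a, a', b, b'}" G] G'(2) s by simp
    have "detached ?F ?A" using detached_Un[OF P G'(3)] g(1) by (simp add: detached_insert_iff)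
    then have "set r \<subseteq> ?A" by (rule is_path_detached[OF _ r(2)]) (use ar in auto)
    moreover have "card ?A \<le> card (set r)" using card is_path_length[OF r(2)] r(1) by simp
    ultimately have r_all: "set r = ?A" using card_seteq[OF fin] by blast
    obtain u w where uw: "r = u @ a # w" using ar by (metis split_list)
    have p: "is_path ?F u" "is_path ?F w" "a \<notin> set u" "a \<notin> set w"
      using r(2) unfolding uw by (auto simp: is_path_append is_path_Cons)
    then have p': "is_path (delete_vertex a E) u" "is_path (delete_vertex a E) w"
      using is_path_delete_vertex[of ?F u a] is_path_delete_vertex[of ?F w a] unfolding delF by auto
    have cover: "set u \<union> set w = ?A - {a}" using r_all p(3,4) unfolding uw by auto
    have "a' \<in> set u \<union> set w" "b \<in> set u \<union> set w" "g \<in> set u \<union> set w"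
      using cover ne G(2) g(1) by auto
    moreover have "\<not> (a' \<in> set y \<and> b \<in> set y)" "\<not> (a' \<in> set y \<and> g \<in> set y)"
      "\<not> (b \<in> set y \<and> g \<in> set y)" if "is_path (delete_vertex a E) y" for y
      using is_path_detached[OF det(1) that] is_path_detached[OF det(2) that]
        is_path_detached[OF detG that] ne other g(1) by auto
    ultimately show False using p' by blast
  qed
  have ag: "a \<noteq> g" using G(2) g(1) by auto
  have vF: "valid s n ?F" using noF v lt gn ag unfolding valid_def by auto
  have legal: "{a, g} \<in> legal_moves s n E" using legal_moves_iff[OF v] notin vF by blast
  have c1: "card (clique_components n E 2) \<le> card (clique_components n ?F 2) + 2"
    by (rule card_clique_components_insert)
  have "winning s n d Player_Mini ?F"
  proof (rule winning.mini_move)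
    show "legal_moves s n ?F \<noteq> {}"
      by (rule legal_moves_nonempty[OF vF]) (use s c1 fodder in auto)
  next
    fix e assume "e \<in> legal_moves s n ?F"
    then have vH: "valid s n (insert e ?F)" and "e \<in> complete_edges n"
      using legal_moves_iff[OF vF] unfolding legal_moves_def by auto
    then obtain p q where e: "e = {p, q}" using complete_edgesE by metis
    let ?H = "insert e ?F"
    have "card (clique_components n ?F 2) \<le> card (clique_components n ?H 2) + 2"
      unfolding e by (rule card_clique_components_insert)
    then have fodder': "4 * d \<le> card (clique_components n ?H 2)" using c1 fodder by simp
    have sp: "winning s n d Player_Max ?H" if "split_legs 2 ?H c" "c < n" for c
      by (rule split_legs_wins[OF vH that(1) _ _ that(2) fodder']) (use s in auto)
    have cl: "{x, y} \<in> ?H" if "x \<in> G" "y \<in> G" "x \<noteq> y" for x y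
      using G'(4) that unfolding clique_def by blast
    have legb: "leg 2 ?H a [b, b']" using edges ne
      by (auto simp: leg_def is_path_Cons insert_commute)
    have lega: "leg 2 ?H a [g, g1]" using cl[of g g1] g G(2)
      by (auto simp: leg_def is_path_Cons insert_commute)
    let ?Y = "{b, b'}"
    have delH: "delete_vertex a ?H = (if a \<in> e then delete_vertex a E else insert e (delete_vertex a E))"
      using delF by (simp add: delete_vertex_insert)
    consider (onG) "a \<in> e \<or> (p \<in> G \<longleftrightarrow> q \<in> G)" | (onY) "a \<in> e \<or> (p \<in> ?Y \<longleftrightarrow> q \<in> ?Y)"
      | (cross) x y where "e = {x, y}" "x \<in> G" "y \<in> ?Y"
      using other e by blast
    then show "winning s n d Player_Max ?H"
    proof cases
      case onG
      then have "detached (delete_vertex a ?H) G" unfolding e delH[unfolded e]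
        using detG by (auto simp: detached_insert_iff)
      then have "split_legs 2 ?H a" unfolding split_legs_def
        using legb lega G(2) g other by (intro exI[of _ G] exI[of _ "[g, g1]"] exI[of _ "[b, b']"]) auto
      then show ?thesis using sp lt by blast
    next
      case onY
      then have "detached (delete_vertex a ?H) ?Y" unfolding e delH[unfolded e]
        using det(2) by (auto simp: detached_insert_iff)
      then have "split_legs 2 ?H a" unfolding split_legs_def
        using legb lega ne g other
        by (intro exI[of _ ?Y] exI[of _ "[b, b']"] exI[of _ "[g, g1]"]) auto
      then show ?thesis using sp lt by blast
    next
      case (cross x y)
      show ?thesis
      proof (cases "x = g")
        case True
        have "delete_vertex g ?H = delete_vertex g E" using True cross(1)
          by (simp add: delete_vertex_insert)
        moreover have "detached (delete_vertex g E) (G - {g})"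
          using G'(3) unfolding detached_def delete_vertex_def by blast
        ultimately have "detached (delete_vertex g ?H) (G - {g})" by simp
        moreover have "leg 2 ?H g [g1, g2]" using cl[of g g1] cl[of g1 g2] g
          by (auto simp: leg_def is_path_Cons insert_commute)
        moreover have "leg 2 ?H g [a, a']" using edges ne ag other(1) g(1)
          by (auto simp: leg_def is_path_Cons insert_commute)
        ultimately have "split_legs 2 ?H g" unfolding split_legs_def
          using g G(2) other
          by (intro exI[of _ "G - {g}"] exI[of _ "[g1, g2]"] exI[of _ "[a, a']"]) auto
        then show ?thesis using sp gn by blast
      next
        case False
        have "finite (G - {x, g})" using finG by simp
        then obtain m where m: "set m = G - {x, g}" "distinct m" using finite_distinct_list by metis
        define fs where "fs = x # m @ [g]"
        have fs: "distinct fs" "set fs = G" "hd fs = x" "last fs = g" "fs \<noteq> []"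
          using m False cross(2) g(1) unfolding fs_def by auto
        then have len: "length fs = s - 4" using G'(2) distinct_card by metis
        have path: "is_path ?H fs"
          by (rule clique_is_path[of _ G]) (use fs G'(4) clique_mono[of E G ?H] in auto)
        have yx: "{y, x} \<in> ?H" using cross(1) by (simp add: insert_commute)
        \<comment> \<open>\<open>fs\<close> runs through all of \<open>G\<close> from
          \<open>x\<close> to \<open>g\<close>. For \<open>y = b\<close> the path is b', b,
          \<open>fs\<close>, a, a', returning through the edge of Max; for \<open>y = b'\<close> it
          is a', a, b, b', \<open>fs\<close>. Both have s vertices, so Mini's edge was
          illegal.\<close>
        have "\<exists>r. is_path ?H r \<and> length r = s"
        proof (cases "y = b")
          case True
          have "is_path ?H ([b', b] @ fs @ [a, a'])"
            using path fs yx True edges ne other G(2)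
            by (auto simp: is_path_append is_path_Cons insert_commute)
          then show ?thesis using len s by (intro exI[of _ "[b', b] @ fs @ [a, a']"]) auto
        next
          case False
          then have "y = b'" using cross(3) by simp
          then have "is_path ?H ([a', a, b, b'] @ fs)"
            using path fs yx edges ne other G(2)
            by (auto simp: is_path_append is_path_Cons insert_commute)
          then show ?thesis using len s by (intro exI[of _ "[a', a, b, b'] @ fs"]) auto
        qed
        then show ?thesis using vH unfolding valid_def contains_path_iff by blast
      qed
    qed
  qed
  then show ?thesis using legal winning.max_move by blast
qed

section \<open>The parity argument without isolated vertices\<close>

definition components_partition :: "nat \<Rightarrow> nat set set \<Rightarrow> nat set set \<Rightarrow> bool" where
  "components_partition n E \<D> \<longleftrightarrow> partition_on {..<n} \<D> \<and> (\<forall>D\<in>\<D>. detached E D)"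

text \<open>For \<open>A = B\<close> nothing changes, so edges inside a part are covered by the same
  lemmas as edges between parts.\<close>

definition merge :: "'a set set \<Rightarrow> 'a set \<Rightarrow> 'a set \<Rightarrow> 'a set set" where
  "merge \<D> A B = insert (A \<union> B) (\<D> - {A, B})"

definition cliques :: "nat set set \<Rightarrow> nat set set \<Rightarrow> nat \<Rightarrow> nat set set" where
  "cliques E \<D> r = {D \<in> \<D>. card D = r \<and> clique E D}"

lemma components_partitionD:
  assumes "components_partition n E \<D>" "D \<in> \<D>"
  shows "detached E D" "D \<subseteq> {..<n}" "finite D" "D \<noteq> {}" "card D \<noteq> 0"
proof -
  show "detached E D" using assms unfolding components_partition_def by blast
  show *: "D \<subseteq> {..<n}" "D \<noteq> {}" using assms unfolding components_partition_def partition_on_def by auto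
  show "finite D" using * finite_subset by blast
  then show "card D \<noteq> 0" using * by simp
qed

lemma components_partition_unique:
  "components_partition n E \<D> \<Longrightarrow> A \<in> \<D> \<Longrightarrow> B \<in> \<D> \<Longrightarrow> x \<in> A \<Longrightarrow> x \<in> B \<Longrightarrow> A = B"
  unfolding components_partition_def partition_on_def disjoint_def by blast

lemma components_partition_ex:
  assumes "components_partition n E \<D>" "v < n"
  obtains D where "D \<in> \<D>" "v \<in> D"
  using assms unfolding components_partition_def partition_on_def by blast

lemma components_partition_finite: "components_partition n E \<D> \<Longrightarrow> finite \<D>"
  unfolding components_partition_def by (meson finite_elements finite_lessThan)

lemma merge_same [simp]: "A \<in> \<D> \<Longrightarrow> merge \<D> A A = \<D>"
  unfolding merge_def by auto

lemma components_partition_merge: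
  assumes p: "components_partition n E \<D>" and A: "A \<in> \<D>" "a \<in> A" and B: "B \<in> \<D>" "b \<in> B"
  shows "components_partition n (insert {a, b} E) (merge \<D> A B)"
proof -
  have "partition_on {..<n} (merge \<D> A B)"
  proof (rule partition_onI)
    show "\<Union> (merge \<D> A B) = {..<n}"
      using p A(1) B(1) unfolding components_partition_def partition_on_def merge_def by blast
    show "{} \<notin> merge \<D> A B"
      using A(2) components_partitionD(4)[OF p] unfolding merge_def by auto
    show "disjnt C D" if "C \<in> merge \<D> A B" "D \<in> merge \<D> A B" "C \<noteq> D" for C D
      using that components_partition_unique[OF p] A(1) B(1) unfolding merge_def disjnt_def
      by blast
  qed
  moreover have "detached (insert {a, b} E) D" if "D \<in> merge \<D> A B" for D
  proof (cases "D = A \<union> B")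
    case True
    then show ?thesis using A B components_partitionD(1)[OF p]
      by (auto simp: detached_insert_iff intro: detached_Un)
  next
    case False
    then have "D \<in> \<D>" "D \<noteq> A" "D \<noteq> B" using that unfolding merge_def by auto
    moreover from this have "a \<notin> D" "b \<notin> D" using components_partition_unique[OF p] A B by blast+
    ultimately show ?thesis using components_partitionD(1)[OF p] by (auto simp: detached_insert_iff)
  qed
  ultimately show ?thesis unfolding components_partition_def by blast
qed

lemma components_partition_insert:
  assumes "components_partition n E \<D>" "D \<in> \<D>" "a \<in> D" "b \<in> D"
  shows "components_partition n (insert {a, b} E) \<D>"
  using components_partition_merge[OF assms(1,2,3,2,4)] assms(2) by simp

lemma cliques_subset:
  "components_partition n E \<D> \<Longrightarrow> cliques E \<D> r \<subseteq> clique_components n E r"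
  unfolding cliques_def clique_components_def using components_partitionD by blast

lemma card_cliques_le:
  "components_partition n E \<D> \<Longrightarrow> card (cliques E \<D> r) \<le> card (clique_components n E r)"
  by (intro card_mono cliques_subset) auto

lemma finite_cliques: "components_partition n E \<D> \<Longrightarrow> finite (cliques E \<D> r)"
  unfolding cliques_def using components_partition_finite by simp

lemma cliques_mono: "E \<subseteq> F \<Longrightarrow> cliques E \<D> r \<subseteq> cliques F \<D> r"
  unfolding cliques_def using clique_mono by blast

text \<open>What makes it fatal for Mini to join two parts; the single edge is the exception that
  needs \<open>K_(s-4)\<close>. This is weaker than a spanning cycle on purpose: two triangles
  joined by an edge and a triangle with a pendant vertex are thick too. Added edges preserve
  it.\<close>

definition thick :: "nat set set \<Rightarrow> nat set \<Rightarrow> bool" where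
  "thick E D \<longleftrightarrow> card D = 2 \<and> clique E D \<or> (\<forall>u\<in>D. \<exists>p. leg 2 E u p \<and> set p \<subseteq> D)"

lemma thick_mono:
  assumes "thick E D" "E \<subseteq> F"
  shows "thick F D"
  using assms leg_mono[of 2 E _ _ F] clique_mono[of E D F] unfolding thick_def by blast

lemma thick_leg1:
  assumes "thick E D" "u \<in> D"
  obtains p where "leg 1 E u p" "set p \<subseteq> D"
proof (cases "card D = 2 \<and> clique E D")
  case True
  then obtain x y where "D = {x, y}" "x \<noteq> y" by (auto simp: card_2_iff)
  then obtain w where w: "w \<in> D" "w \<noteq> u" using assms(2) by auto
  then have "leg 1 E u [w]" using True assms(2) unfolding leg_def clique_def by (auto simp: is_path_Cons)
  then show ?thesis using that w by auto
next
  case False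
  then obtain p where p: "leg 2 E u p" "set p \<subseteq> D" using assms unfolding thick_def by blast
  then obtain x y where "p = [x, y]" by (auto simp: leg_def length_Suc_conv numeral_2_eq_2)
  then have "leg 1 E u [x]" "set [x] \<subseteq> D" using p by (auto simp: leg_def is_path_Cons)
  then show ?thesis using that by blast
qed

text \<open>If one end has a leg of two vertices in its own part, then on the other side the far end
  and one more vertex form the second leg; every vertex of a thick part has such a neighbour. The
  joining edge spoils at most two of the \<open>4 * d + 8\<close> isolated edges, and the rest
  covers the case of two single edges.\<close>

lemma join_thick_wins:
  assumes v: "valid s n (insert {a, b} E)" and p: "components_partition n E \<D>" and s: "7 \<le> s"
    and A: "A \<in> \<D>" "a \<in> A" "thick E A" and B: "B \<in> \<D>" "b \<in> B" "thick E B" and AB: "A \<noteq> B"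
    and G: "cliques E \<D> (s - 4) \<noteq> {}" and fodder: "4 * d + 8 \<le> card (cliques E \<D> 2)"
  shows "winning s n d Player_Max (insert {a, b} E)"
proof -
  let ?F = "insert {a, b} E"
  have det: "detached E A" "detached E B" using components_partitionD(1)[OF p] A(1) B(1) by auto
  have disj: "A \<inter> B = {}" using components_partition_unique[OF p A(1) B(1)] AB by blast
  have n: "a < n" "b < n" using valid_edge[OF v, of a b] by auto
  have "card (clique_components n E 2) \<le> card (clique_components n ?F 2) + 2"
    by (rule card_clique_components_insert)
  then have fodder': "4 * d + 6 \<le> card (clique_components n ?F 2)"
    using fodder card_cliques_le[OF p, of 2] by simp
  have join: "winning s n d Player_Max ?F"
    if C: "detached E C" "x \<notin> C" "y \<in> C" "thick E C" "leg 2 E x q" "set q \<inter> C = {}"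
      and xy: "{x, y} = {a, b}" "x < n" for C x y q
  proof -
    obtain r where "leg 1 E y r" "set r \<subseteq> C" using thick_leg1 C by blast
    then have "split_legs 2 (insert {x, y} E) x"
      using split_legs_join[of E C x y 2 q r] C by simp
    then have "split_legs 2 ?F x" using xy(1) by simp
    then show ?thesis by (rule split_legs_wins[OF v]) (use fodder' s xy(2) in auto)
  qed
  consider (onA) "\<forall>u\<in>A. \<exists>p. leg 2 E u p \<and> set p \<subseteq> A" | (onB) "\<forall>u\<in>B. \<exists>p. leg 2 E u p \<and> set p \<subseteq> B"
    | (edges) "card A = 2" "clique E A" "card B = 2" "clique E B"
    using A(3) B(3) unfolding thick_def by blast
  then show ?thesis
  proof cases
    case onA
    then obtain q where "leg 2 E a q" "set q \<subseteq> A" using assms(5) by blast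
    then show ?thesis using join[of B a b q] det B(2,3) disj assms(5) n by blast
  next
    case onB
    then obtain q where "leg 2 E b q" "set q \<subseteq> B" using assms(8) by blast
    then show ?thesis using join[of A b a q] det A(2,3) disj assms(8) n by blast
  next
    case edges
    obtain a' where a': "A = {a, a'}" "a \<noteq> a'"
      using edges(1) A(2) by (auto simp: card_2_iff)
    obtain b' where b': "B = {b, b'}" "b \<noteq> b'"
      using edges(3) B(2) by (auto simp: card_2_iff)
    obtain G where G: "G \<in> \<D>" "card G = s - 4" "clique E G" using assms(11) unfolding cliques_def by blast
    have "G \<noteq> A" "G \<noteq> B" using G(2) edges s by auto
    then have out: "a \<notin> G" "b \<notin> G" using components_partition_unique[OF p] G(1) A B by blast+
    have detG: "detached ?F G" "G \<subseteq> {..<n}"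
      using components_partitionD[OF p G(1)] out by (auto simp: detached_insert_iff)
    have del: "delete_vertex a ?F = delete_vertex a E" by (simp add: delete_vertex_insert)
    show ?thesis
    proof (rule two_edges_joined_wins[OF v s, of a a' b b' G])
      show "{a, a'} \<in> ?F" "{b, b'} \<in> ?F" using edges a' b' unfolding clique_def by auto
      show "distinct [a, a', b, b']" using a' b' disj by auto
      show "detached ?F {a, a', b, b'}"
        using detached_Un[OF det] a' b' by (auto simp: detached_insert_iff insert_commute)
      have "detached (delete_vertex a E) (A - {a})"
        using det(1) unfolding detached_def delete_vertex_def by blast
      then show "detached (delete_vertex a ?F) {a'}" unfolding del using a' by simp
      show "detached (delete_vertex a ?F) {b, b'}" unfolding del
        using det(2) b' by (auto intro: detached_delete_vertex)
      show "G \<in> clique_components n ?F (s - 4)"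
        using detG G clique_mono[of E G ?F] unfolding clique_components_def by auto
    qed (use out fodder' in auto)
  qed
qed

section \<open>Parity of the missing pairs\<close>

definition missing :: "nat \<Rightarrow> nat set set \<Rightarrow> nat set set \<Rightarrow> nat set set" where
  "missing n E \<D> = {e \<in> complete_edges n - E. \<exists>D\<in>\<D>. e \<subseteq> D}"

text \<open>Every missing pair inside a part may be claimed at any time, so the parity of the number of
  missing pairs decides who has to join two parts first. Thickness excludes isolated vertices.\<close>
definition filling :: "nat \<Rightarrow> nat \<Rightarrow> nat set set \<Rightarrow> nat set set \<Rightarrow> bool" where
  "filling s n E \<D> \<longleftrightarrow> valid s n E \<and> components_partition n E \<D> \<and>
     (\<forall>D\<in>\<D>. card D < s \<and> thick E D)"

lemma finite_missing [simp]: "finite (missing n E \<D>)"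
  unfolding missing_def by simp

lemma filling_insert:
  assumes f: "filling s n E \<D>" and e: "e \<in> missing n E \<D>"
  shows "e \<in> legal_moves s n E" "filling s n (insert e E) \<D>"
    "card (missing n E \<D>) = Suc (card (missing n (insert e E) \<D>))"
    "cliques E \<D> r \<subseteq> cliques (insert e E) \<D> r"
proof -
  obtain D where D: "D \<in> \<D>" "e \<subseteq> D" "e \<in> complete_edges n" "e \<notin> E"
    using e unfolding missing_def by blast
  obtain a b where ab: "e = {a, b}" "a \<noteq> b" using D(3) complete_edgesE by metis
  have p: "components_partition n E \<D>" and v: "valid s n E" and card: "card D < s"
    using f D(1) unfolding filling_def by auto
  have v': "valid s n (insert e E)" unfolding ab
    by (rule valid_insert_within[OF v]) (use components_partitionD[OF p D(1)] D(2) ab card in auto)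
  then show "e \<in> legal_moves s n E" using legal_moves_iff[OF v] D(4) by blast
  have "components_partition n (insert e E) \<D>"
    using components_partition_insert[OF p D(1)] D(2) unfolding ab by blast
  then show "filling s n (insert e E) \<D>"
    using v' f thick_mono[of E _ "insert e E"] unfolding filling_def by blast
  have "missing n E \<D> = insert e (missing n (insert e E) \<D>)" "e \<notin> missing n (insert e E) \<D>"
    using e unfolding missing_def by auto
  then show "card (missing n E \<D>) = Suc (card (missing n (insert e E) \<D>))" by simp
  show "cliques E \<D> r \<subseteq> cliques (insert e E) \<D> r" by (rule cliques_mono) auto
qed

lemma filling_Mini_move:
  assumes f: "filling s n E \<D>" and e: "e \<in> legal_moves s n E" and s: "7 \<le> s"
    and G: "cliques E \<D> (s - 4) \<noteq> {}" and fodder: "4 * d + 8 \<le> card (cliques E \<D> 2)"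
  shows "winning s n d Player_Max (insert e E) \<or> e \<in> missing n E \<D>"
proof -
  have v: "valid s n E" and p: "components_partition n E \<D>" and t: "\<And>D. D \<in> \<D> \<Longrightarrow> thick E D"
    using f unfolding filling_def by auto
  have e': "e \<in> complete_edges n" "e \<notin> E" using e unfolding legal_moves_def by auto
  then obtain a b where ab: "e = {a, b}" "a < n" "b < n" using complete_edgesE by metis
  obtain A where A: "A \<in> \<D>" "a \<in> A" using components_partition_ex[OF p ab(2)] .
  obtain B where B: "B \<in> \<D>" "b \<in> B" using components_partition_ex[OF p ab(3)] .
  show ?thesis
  proof (cases "A = B")
    case True
    then show ?thesis using e' A B ab unfolding missing_def by auto
  next
    case False
    have "valid s n (insert e E)" using e legal_moves_iff[OF v] by blast
    then show ?thesis
      using join_thick_wins[OF _ p s A t[OF A(1)] B t[OF B(1)] False G fodder] ab(1) by blast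
  qed
qed

lemma card_cliques_mono_le:
  assumes "components_partition n F \<D>" "E \<subseteq> F"
  shows "card (cliques E \<D> r) \<le> card (cliques F \<D> r)"
  using assms cliques_mono[of E F] finite_cliques by (simp add: card_mono)

text \<open>After Mini claims a missing pair their number is odd, so Max finds another one and
  restores the parity. When none is left the game still goes on, since isolated edges can be joined,
  and Mini has to make the first join.\<close>

lemma filling_even_wins:
  assumes "filling s n E \<D>" "7 \<le> s" "even (card (missing n E \<D>))"
    and "cliques E \<D> (s - 4) \<noteq> {}" "4 * d + 8 \<le> card (cliques E \<D> 2)"
  shows "winning s n d Player_Mini E"
  using assms
proof (induction "card (missing n E \<D>)" arbitrary: E rule: less_induct)
  case less
  have v: "valid s n E" and p: "components_partition n E \<D>"
    using less.prems(1) unfolding filling_def by auto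
  show ?case
  proof (rule winning.mini_move)
    show "legal_moves s n E \<noteq> {}"
      by (rule legal_moves_nonempty[OF v]) (use less.prems card_cliques_le[OF p, of 2] in auto)
  next
    fix e assume e: "e \<in> legal_moves s n E"
    show "winning s n d Player_Max (insert e E)"
    proof (cases "e \<in> missing n E \<D>")
      case True
      let ?F = "insert e E"
      note F = filling_insert[OF less.prems(1) True]
      have "odd (card (missing n ?F \<D>))" using F(3) less.prems(3) by simp
      then have "missing n ?F \<D> \<noteq> {}" by auto
      then obtain e' where e': "e' \<in> missing n ?F \<D>" by blast
      note H = filling_insert[OF F(2) e']
      have pH: "components_partition n (insert e' ?F) \<D>" using H(2) unfolding filling_def by blast
      have "winning s n d Player_Mini (insert e' ?F)"
      proof (rule less.hyps)
        show "cliques (insert e' ?F) \<D> (s - 4) \<noteq> {}"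
          using less.prems(4) F(4) H(4) by blast
        have "card (cliques E \<D> 2) \<le> card (cliques (insert e' ?F) \<D> 2)"
          by (rule card_cliques_mono_le[OF pH]) auto
        then show "4 * d + 8 \<le> card (cliques (insert e' ?F) \<D> 2)" using less.prems(5) by simp
      qed (use F(3) H(2,3) less.prems in auto)
      then show ?thesis using H(1) winning.max_move by blast
    next
      case False
      then show ?thesis using filling_Mini_move[OF less.prems(1) e less.prems(2,4,5)] by blast
    qed
  qed
qed

text \<open>All pairs between \<open>A\<close> and \<open>B\<close> now lie inside one part, and
  none of them was claimed before. The successor accounts for \<open>{a, b}\<close>, which is one of
  them but is claimed.\<close>

lemma card_missing_merge:
  assumes p: "components_partition n E \<D>" and A: "A \<in> \<D>" "a \<in> A" and B: "B \<in> \<D>" "b \<in> B"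
    and AB: "A \<noteq> B"
  shows "Suc (card (missing n (insert {a, b} E) (merge \<D> A B))) = card (missing n E \<D>) + card A * card B"
proof -
  let ?M = "missing n E \<D>" and ?N = "missing n (insert {a, b} E) (merge \<D> A B)"
  define X where "X = (\<lambda>(x, y). {x, y}) ` (A \<times> B)"
  have disj: "A \<inter> B = {}" using components_partition_unique[OF p A(1) B(1)] AB by blast
  note PA = components_partitionD[OF p A(1)] and PB = components_partitionD[OF p B(1)]
  have "inj_on (\<lambda>(x, y). {x, y}) (A \<times> B)"
    using disj by (auto simp: inj_on_def doubleton_eq_iff)
  then have cardX: "card X = card A * card B" unfolding X_def
    by (simp add: card_image card_cartesian_product)
  have finX: "finite X" unfolding X_def using PA(3) PB(3) by simp
  have X: "X \<subseteq> complete_edges n" "X \<inter> E = {}"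
    using PA(2) PB(2) disj detachedD[OF PA(1)] unfolding X_def by auto
  have XM: "X \<inter> ?M = {}"
  proof -
    have False if "x \<in> A" "y \<in> B" "D \<in> \<D>" "{x, y} \<subseteq> D" for x y D
      using components_partition_unique[OF p] that A(1) B(1) AB by blast
    then show ?thesis unfolding X_def missing_def by blast
  qed
  have ab: "{a, b} \<in> X" using A B unfolding X_def by auto
  have "?N = (?M \<union> X) - {{a, b}}"
  proof (intro equalityI subsetI)
    fix e assume "e \<in> ?N"
    then obtain D where e: "e \<in> complete_edges n" "e \<notin> E" "e \<noteq> {a, b}"
      "D \<in> merge \<D> A B" "e \<subseteq> D"
      unfolding missing_def by auto
    obtain x y where xy: "e = {x, y}" using e(1) complete_edgesE by metis
    show "e \<in> (?M \<union> X) - {{a, b}}"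
    proof (cases "D \<in> \<D>")
      case False
      then have "D = A \<union> B" using e(4) unfolding merge_def by blast
      then consider "e \<subseteq> A" | "e \<subseteq> B" | "x \<in> A" "y \<in> B" | "y \<in> A" "x \<in> B"
        using e(5) xy by blast
      then show ?thesis
      proof cases
        case 3
        then show ?thesis using xy e(3) unfolding X_def by blast
      next
        case 4
        then have "e = {y, x}" using xy by blast
        then show ?thesis using 4 e(3) unfolding X_def by blast
      qed (use e A(1) B(1) in \<open>auto simp: missing_def\<close>)
    qed (use e in \<open>auto simp: missing_def\<close>)
  next
    fix e assume "e \<in> (?M \<union> X) - {{a, b}}"
    then have e: "e \<noteq> {a, b}" "e \<in> ?M \<or> e \<in> X" by auto
    then have "e \<in> complete_edges n" "e \<notin> E" using X unfolding missing_def by auto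
    moreover have "\<exists>D\<in>merge \<D> A B. e \<subseteq> D"
    proof (cases "e \<in> X")
      case True
      then have "e \<subseteq> A \<union> B" unfolding X_def by auto
      then show ?thesis unfolding merge_def by blast
    next
      case False
      then obtain D where "D \<in> \<D>" "e \<subseteq> D" using e(2) unfolding missing_def by blast
      then show ?thesis unfolding merge_def by (cases "D \<in> {A, B}") auto
    qed
    ultimately show "e \<in> ?N" using e(1) unfolding missing_def by blast
  qed
  then have "card ?N = card (?M \<union> X) - 1" using ab finX by simp
  moreover have "card (?M \<union> X) = card ?M + card X"
    using XM finX by (intro card_Un_disjoint) auto
  moreover have "card X \<noteq> 0" using ab finX by auto
  ultimately show ?thesis using cardX by simp
qed

text \<open>Claiming a missing pair passes an even number to Mini if the number was odd. If it was
  even, joining two triangles changes it by 9 - 1 = 8 and so passes the turn without changing the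
  parity.\<close>

lemma filling_wins_Max:
  assumes f: "filling s n E \<D>" and s: "7 \<le> s"
    and G: "cliques E \<D> (s - 4) \<noteq> {}" and T: "3 \<le> card (cliques E \<D> 3)"
    and fodder: "4 * d + 8 \<le> card (cliques E \<D> 2)"
  shows "winning s n d Player_Max E"
proof (cases "even (card (missing n E \<D>))")
  case False
  then have "missing n E \<D> \<noteq> {}" by auto
  then obtain e where e: "e \<in> missing n E \<D>" by blast
  note F = filling_insert[OF f e]
  have pF: "components_partition n (insert e E) \<D>" using F(2) unfolding filling_def by blast
  have "winning s n d Player_Mini (insert e E)"
  proof (rule filling_even_wins[OF F(2) s])
    show "cliques (insert e E) \<D> (s - 4) \<noteq> {}" using F(4) G by blast
    have "card (cliques E \<D> 2) \<le> card (cliques (insert e E) \<D> 2)"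
      by (rule card_cliques_mono_le[OF pF]) auto
    then show "4 * d + 8 \<le> card (cliques (insert e E) \<D> 2)" using fodder by simp
  qed (use False F(3) in auto)
  then show ?thesis using F(1) winning.max_move by blast
next
  case True
  have v: "valid s n E" and p: "components_partition n E \<D>" using f unfolding filling_def by auto
  have "\<not> card (cliques E \<D> 3) \<le> Suc 0" using T by simp
  then obtain A B where AB: "A \<in> cliques E \<D> 3" "B \<in> cliques E \<D> 3" "A \<noteq> B"
    using card_le_Suc0_iff_eq[OF finite_cliques[OF p]] by metis
  then have A: "A \<in> \<D>" "card A = 3" "clique E A" and B: "B \<in> \<D>" "card B = 3" "clique E B"
    unfolding cliques_def by auto
  note PA = components_partitionD[OF p A(1)] and PB = components_partitionD[OF p B(1)]
  obtain a b where ab: "a \<in> A" "b \<in> B" using PA(4) PB(4) by blast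
  have disj: "A \<inter> B = {}" using components_partition_unique[OF p A(1) B(1)] AB(3) by blast
  let ?F = "insert {a, b} E" and ?D = "merge \<D> A B"
  have c6: "card (A \<union> B) < s" using card_Un_le[of A B] A(2) B(2) s by simp
  have "{a, b} \<notin> E" using detachedD[OF PA(1)] ab disj by blast
  moreover have vF: "valid s n ?F"
    by (rule valid_insert_within[OF v detached_Un[OF PA(1) PB(1)]]) (use ab disj PA PB c6 in auto)
  ultimately have legal: "{a, b} \<in> legal_moves s n E" using legal_moves_iff[OF v] by blast
  have pF: "components_partition n ?F ?D"
    by (rule components_partition_merge[OF p A(1) ab(1) B(1) ab(2)])
  have thickK3: "\<exists>p. leg 2 E u p \<and> set p \<subseteq> C" if K: "clique E C" "card C = 3" "u \<in> C" for C u
  proof -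
    have "finite C" using K(2) card_ge_0_finite[of C] by simp
    then have "spanned_by_cycle E C" using clique_spanned_by_cycle[OF K(1)] K(2) by simp
    then obtain q where "leg 2 E u q" "set q \<subseteq> C - {u}"
      by (rule spanned_by_cycle_leg[where l = 2]) (use K in auto)
    then show ?thesis by blast
  qed
  have sub: "cliques E \<D> r - {A, B} \<subseteq> cliques ?F ?D r" for r
    unfolding cliques_def merge_def using clique_mono[of E _ ?F] by auto
  have "filling s n ?F ?D"
    unfolding filling_def
  proof (intro conjI vF pF ballI)
    fix D assume D: "D \<in> ?D"
    show "card D < s" using D c6 f unfolding merge_def filling_def by auto
    show "thick ?F D"
    proof (cases "D = A \<union> B")
      case True
      have "\<exists>p. leg 2 ?F u p \<and> set p \<subseteq> D" if "u \<in> D" for u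
      proof -
        have "\<exists>p. leg 2 E u p \<and> set p \<subseteq> D"
          using thickK3[OF A(3,2), of u] thickK3[OF B(3,2), of u] that True by blast
        then show ?thesis using leg_mono[of 2 E u _ ?F] by blast
      qed
      then show ?thesis unfolding thick_def by blast
    next
      case False
      then have "thick E D" using D f unfolding merge_def filling_def by blast
      then show ?thesis by (rule thick_mono) auto
    qed
  qed
  moreover have "even (card (missing n ?F ?D))"
  proof -
    have "Suc (card (missing n ?F ?D)) = card (missing n E \<D>) + 9"
      using card_missing_merge[OF p A(1) ab(1) B(1) ab(2) AB(3)] A(2) B(2) by simp
    then show ?thesis using True by presburger
  qed
  \<comment> \<open>For \<open>s = 7\<close> the cliques on s - 4 vertices are triangles themselves.
    The third triangle in the hypothesis is the one that survives the join.\<close>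
  moreover have "cliques ?F ?D (s - 4) \<noteq> {}"
  proof (cases "s = 7")
    case True
    have "card (cliques E \<D> 3) - card {A, B} \<le> card (cliques E \<D> 3 - {A, B})"
      by (rule diff_card_le_card_Diff) simp
    moreover have "card {A, B} = 2" using AB(3) by simp
    ultimately have "card (cliques E \<D> 3 - {A, B}) \<noteq> 0" using T by simp
    then have "cliques E \<D> 3 - {A, B} \<noteq> {}" by (metis card.empty)
    then show ?thesis using sub[of 3] True by auto
  next
    case False
    then have "cliques E \<D> (s - 4) - {A, B} = cliques E \<D> (s - 4)"
      using A(2) B(2) s unfolding cliques_def by auto
    then show ?thesis using sub[of "s - 4"] G by auto
  qed
  moreover have "card (cliques E \<D> 2) \<le> card (cliques ?F ?D 2)"
  proof (rule card_mono[OF finite_cliques[OF pF]])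
    have "cliques E \<D> 2 - {A, B} = cliques E \<D> 2" using A(2) B(2) unfolding cliques_def by auto
    then show "cliques E \<D> 2 \<subseteq> cliques ?F ?D 2" using sub[of 2] by simp
  qed
  ultimately have "winning s n d Player_Mini ?F"
    using fodder by (intro filling_even_wins[OF _ s]) auto
  then show ?thesis using legal winning.max_move by blast
qed

lemma filling_wins_Mini:
  assumes f: "filling s n E \<D>" and s: "7 \<le> s"
    and G: "cliques E \<D> (s - 4) \<noteq> {}" and T: "3 \<le> card (cliques E \<D> 3)"
    and fodder: "4 * d + 8 \<le> card (cliques E \<D> 2)"
  shows "winning s n d Player_Mini E"
proof (rule winning.mini_move)
  have v: "valid s n E" and p: "components_partition n E \<D>" using f unfolding filling_def by auto
  show "legal_moves s n E \<noteq> {}"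
    by (rule legal_moves_nonempty[OF v]) (use s fodder card_cliques_le[OF p, of 2] in auto)
  fix e assume e: "e \<in> legal_moves s n E"
  show "winning s n d Player_Max (insert e E)"
  proof (cases "e \<in> missing n E \<D>")
    case True
    note F = filling_insert[OF f True]
    have pF: "components_partition n (insert e E) \<D>" using F(2) unfolding filling_def by blast
    have le: "card (cliques E \<D> r) \<le> card (cliques (insert e E) \<D> r)" for r
      by (rule card_cliques_mono_le[OF pF]) auto
    show ?thesis
      by (rule filling_wins_Max[OF F(2) s]) (use F(4)[of "s - 4"] G T fodder le[of 3] le[of 2] in auto)
  next
    case False
    then show ?thesis using filling_Mini_move[OF f e s G fodder] by blast
  qed
qed

section \<open>Positions with few isolated vertices\<close>

definition singles :: "'a set set \<Rightarrow> 'a set set" where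
  "singles \<D> = {D \<in> \<D>. card D = 1}"

text \<open>A spanning cycle is what a single edge can restore after Mini has attached an isolated
  vertex. It makes the part thick, and opened to a path it shows that the part has fewer than s
  vertices.\<close>

definition calm :: "nat \<Rightarrow> nat \<Rightarrow> nat set set \<Rightarrow> nat set set \<Rightarrow> bool" where
  "calm s n E \<D> \<longleftrightarrow> valid s n E \<and> components_partition n E \<D> \<and>
     (\<forall>D\<in>\<D>. card D \<noteq> 1 \<longrightarrow> spanned_by_cycle E D)"

lemma calmD:
  assumes "calm s n E \<D>"
  shows "valid s n E" "components_partition n E \<D>"
    "D \<in> \<D> \<Longrightarrow> card D \<noteq> 1 \<Longrightarrow> spanned_by_cycle E D"
  using assms unfolding calm_def by auto

lemma finite_singles: "components_partition n E \<D> \<Longrightarrow> finite (singles \<D>)"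
  unfolding singles_def using components_partition_finite by simp

lemma card_singles_le:
  assumes "components_partition n E \<D>"
  shows "card (singles \<D>) \<le> card (clique_components n E 1)"
proof -
  have "singles \<D> \<subseteq> cliques E \<D> 1"
    unfolding singles_def cliques_def clique_def by (auto simp: card_1_singleton_iff)
  then have "card (singles \<D>) \<le> card (cliques E \<D> 1)"
    using finite_cliques[OF assms] card_mono by blast
  then show ?thesis using card_cliques_le[OF assms, of 1] by simp
qed

lemma spanned_by_cycle_thick:
  assumes "spanned_by_cycle E D"
  shows "thick E D"
proof (cases "card D = 2")
  case True
  then show ?thesis using spanned_by_cycle_card2[OF assms] unfolding thick_def by blast
next
  case False
  then have "2 < card D" using spanned_by_cycle_card[OF assms] by simp
  then have "\<exists>p. leg 2 E u p \<and> set p \<subseteq> D" if u: "u \<in> D" for u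
    by (rule spanned_by_cycle_leg[OF assms u, where l = 2]) (use \<open>2 < card D\<close> in blast)+
  then show ?thesis unfolding thick_def by blast
qed

lemma spanned_by_cycle_card_less:
  assumes "spanned_by_cycle E D" "\<not> contains_path s E"
  shows "card D < s"
proof -
  obtain p where p: "set p = D" "is_path E p" using assms(1) unfolding spanned_by_cycle_def by blast
  then have "\<not> s \<le> length p" using contains_path_if_long assms(2) by blast
  then show ?thesis using is_path_length[OF p(2)] p(1) by simp
qed

lemma calm_merge:
  assumes c: "calm s n E \<D>" and A: "A \<in> \<D>" "a \<in> A" and B: "B \<in> \<D>" "b \<in> B"
    and v: "valid s n (insert {a, b} E)" and sp: "spanned_by_cycle (insert {a, b} E) (A \<union> B)"
  shows "calm s n (insert {a, b} E) (merge \<D> A B)"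
  unfolding calm_def
proof (intro conjI v ballI impI)
  show "components_partition n (insert {a, b} E) (merge \<D> A B)"
    by (rule components_partition_merge[OF calmD(2)[OF c] A B])
  fix D assume D: "D \<in> merge \<D> A B" "card D \<noteq> 1"
  show "spanned_by_cycle (insert {a, b} E) D"
  proof (cases "D = A \<union> B")
    case False
    then have "spanned_by_cycle E D" using D calmD(3)[OF c] unfolding merge_def by blast
    then show ?thesis using spanned_by_cycle_mono[of E D "insert {a, b} E"] by blast
  qed (use sp in simp)
qed

lemma singles_merge:
  assumes p: "components_partition n E \<D>" and "A \<in> \<D>" "B \<in> \<D>" "A \<noteq> B"
  shows "singles (merge \<D> A B) = singles \<D> - {A, B}"
proof -
  note PA = components_partitionD[OF p assms(2)] and PB = components_partitionD[OF p assms(3)]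
  have "A \<inter> B = {}" using components_partition_unique[OF p assms(2,3)] assms(4) by blast
  then have "card (A \<union> B) = card A + card B" using PA(3) PB(3) by (simp add: card_Un_disjoint)
  then have "card (A \<union> B) \<noteq> 1" using PA(5) PB(5) by simp
  then show ?thesis unfolding singles_def merge_def by auto
qed

lemma cliques_merge: "E \<subseteq> F \<Longrightarrow> cliques E \<D> r - {A, B} \<subseteq> cliques F (merge \<D> A B) r"
  unfolding cliques_def merge_def using clique_mono by blast

lemma merge_commute: "merge \<D> A B = merge \<D> B A"
  unfolding merge_def by (simp add: Un_commute insert_commute)

lemma cliques_merge_single:
  assumes "E \<subseteq> F" "r \<noteq> 1"
  shows "cliques E \<D> r \<subseteq> cliques F (merge \<D> {a} B) r \<union> {B}"
proof -
  have "{a} \<notin> cliques E \<D> r" using assms(2) unfolding cliques_def by auto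
  then show ?thesis using cliques_merge[OF assms(1), of \<D> r "{a}" B] by blast
qed

lemma cliques_merge_singles:
  assumes "E \<subseteq> F" "r \<noteq> 1"
  shows "cliques E \<D> r \<subseteq> cliques F (merge \<D> {a} {b}) r"
proof -
  have "{a} \<notin> cliques E \<D> r" "{b} \<notin> cliques E \<D> r" using assms(2) unfolding cliques_def by auto
  then show ?thesis using cliques_merge[OF assms(1), of \<D> r "{a}" "{b}"] by blast
qed

lemma cliques_large:
  assumes "E \<subseteq> F" "\<D> - singles \<D> \<subseteq> \<D>'" "r \<noteq> 1"
  shows "cliques E \<D> r \<subseteq> cliques F \<D>' r"
  using assms clique_mono[of E _ F] unfolding cliques_def singles_def by blast

lemma singleE:
  assumes "D \<in> singles \<D>"
  obtains w where "D = {w}" "{w} \<in> \<D>"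
  using assms unfolding singles_def by (auto simp: card_1_singleton_iff)

lemma spanned_by_cycle_edge: "a \<noteq> b \<Longrightarrow> {a, b} \<in> E \<Longrightarrow> spanned_by_cycle E {a, b}"
  unfolding spanned_by_cycle_def
  by (intro exI[of _ "[a, b]"]) (auto simp: is_path_Cons insert_commute)

lemma calm_pair_singles:
  assumes c: "calm s n E \<D>" and ab: "{a} \<in> \<D>" "{b} \<in> \<D>" "a \<noteq> b" and s: "2 < s"
  shows "{a, b} \<in> legal_moves s n E" "calm s n (insert {a, b} E) (merge \<D> {a} {b})"
proof -
  note p = calmD(2)[OF c]
  note Pa = components_partitionD[OF p ab(1)] and Pb = components_partitionD[OF p ab(2)]
  have "detached E ({a} \<union> {b})" using detached_Un Pa(1) Pb(1) by blast
  then have v: "valid s n (insert {a, b} E)"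
    by (intro valid_insert_within[OF calmD(1)[OF c], of "{a} \<union> {b}"]) (use ab Pa(2) Pb(2) s in auto)
  have "{a, b} \<notin> E" using detachedD[OF Pa(1)] ab(3) by blast
  then show "{a, b} \<in> legal_moves s n E" using legal_moves_iff[OF calmD(1)[OF c]] v by blast
  show "calm s n (insert {a, b} E) (merge \<D> {a} {b})"
    by (rule calm_merge[OF c ab(1) _ ab(2) _ v])
      (use spanned_by_cycle_edge[of a b "insert {a, b} E"] ab(3) in \<open>auto simp: insert_commute\<close>)
qed

lemma calm_insert_inside:
  assumes c: "calm s n E \<D>" and D: "D \<in> \<D>" "a \<in> D" "b \<in> D" and v: "valid s n (insert {a, b} E)"
  shows "calm s n (insert {a, b} E) \<D>"
proof -
  have "card D \<noteq> 1" using D valid_edge[OF v, of a b] by (auto simp: card_1_singleton_iff)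
  then have "spanned_by_cycle (insert {a, b} E) D"
    using calmD(3)[OF c D(1)] spanned_by_cycle_mono[of E D "insert {a, b} E"] by blast
  then show ?thesis using calm_merge[OF c D(1,2) D(1,3) v] D(1) by simp
qed

text \<open>Quiet moves lie inside a part or pair two isolated vertices; they destroy no spanning
  cycle. In the other case the ends are named so that \<open>B\<close> has a spanning cycle, while
  \<open>A\<close> may be an isolated vertex.\<close>

lemma calm_move_cases:
  assumes c: "calm s n E \<D>" and e: "e \<in> legal_moves s n E"
  obtains
    (quiet) \<D>' where "calm s n (insert e E) \<D>'" "singles \<D>' \<subseteq> singles \<D>"
      "card (singles \<D>) \<le> card (singles \<D>') + 2" "\<D> - singles \<D> \<subseteq> \<D>'"
  | (joining) A B a b where "A \<in> \<D>" "B \<in> \<D>" "A \<noteq> B" "a \<in> A" "b \<in> B" "e = {a, b}" "card B \<noteq> 1"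
proof -
  note v = calmD(1)[OF c] and p = calmD(2)[OF c]
  have e': "e \<in> complete_edges n" "valid s n (insert e E)"
    using e legal_moves_iff[OF v] unfolding legal_moves_def by auto
  obtain a b where ab: "e = {a, b}" "a \<noteq> b" "a < n" "b < n" using e'(1) complete_edgesE by metis
  obtain A where A: "A \<in> \<D>" "a \<in> A" using components_partition_ex[OF p ab(3)] .
  obtain B where B: "B \<in> \<D>" "b \<in> B" using components_partition_ex[OF p ab(4)] .
  have vi: "valid s n (insert {a, b} E)" using e'(2) ab(1) by simp
  consider "A = B" | "A \<noteq> B" "card B \<noteq> 1" | "A \<noteq> B" "card A \<noteq> 1" | "A \<noteq> B" "card A = 1" "card B = 1"
    by blast
  then show ?thesis
  proof cases
    case 1
    have "calm s n (insert e E) \<D>"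
      unfolding ab(1) by (rule calm_insert_inside[OF c A _ vi]) (use B 1 in simp)
    then show ?thesis by (rule quiet) auto
  next
    case 2
    then show ?thesis using joining[of A B a b] A B ab(1) by blast
  next
    case 3
    then show ?thesis using joining[of B A b a] A B ab(1) by (metis insert_commute)
  next
    case 4
    then have AB: "A = {a}" "B = {b}" using A B by (auto simp: card_1_singleton_iff)
    have sp: "spanned_by_cycle (insert {a, b} E) (A \<union> B)"
      using spanned_by_cycle_edge[of a b "insert {a, b} E"] ab(2) AB by (simp add: insert_commute)
    have "calm s n (insert e E) (merge \<D> A B)"
      unfolding ab(1) by (rule calm_merge[OF c A B vi sp])
    moreover have sm: "singles (merge \<D> A B) = singles \<D> - {A, B}"
      by (rule singles_merge[OF p A(1) B(1) 4(1)])
    moreover have "card (singles \<D>) \<le> card (singles (merge \<D> A B)) + 2"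
    proof -
      have "card (singles \<D>) - card {A, B} \<le> card (singles \<D> - {A, B})"
        by (rule diff_card_le_card_Diff) simp
      moreover have "card {A, B} = 2" using 4(1) by simp
      ultimately show ?thesis using sm by simp
    qed
    moreover have "\<D> - singles \<D> \<subseteq> merge \<D> A B"
      using 4 unfolding merge_def singles_def by auto
    ultimately show ?thesis by (intro quiet[of "merge \<D> A B"]) auto
  qed
qed

lemma calm_close_pendant:
  assumes c: "calm s n E \<D>" and a: "{a} \<in> \<D>" and B: "B \<in> \<D>" "b \<in> B" "card B \<noteq> 1"
    and v: "valid s n (insert {a, b} E)"
  obtains x where "{a, x} \<in> legal_moves s n (insert {a, b} E)"
    "calm s n (insert {a, x} (insert {a, b} E)) (merge \<D> {a} B)"
proof -
  note p = calmD(2)[OF c]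
  note Pa = components_partitionD[OF p a] and PB = components_partitionD[OF p B(1)]
  have aB: "a \<notin> B" using components_partition_unique[OF p a B(1)] B(3) by force
  have sp: "spanned_by_cycle E B" using calmD(3)[OF c] B by blast
  obtain x where x: "x \<in> B" "x \<noteq> b" 
    "spanned_by_cycle (insert {a, x} (insert {b, a} E)) (insert a B)"
    using spanned_by_cycle_insert_vertex[OF sp B(2) aB] .
  let ?F = "insert {a, b} E" and ?H = "insert {a, x} (insert {a, b} E)"
  \<comment> \<open>From \<open>a\<close> through \<open>b\<close> and around the cycle runs a path
    through all of \<open>insert a B\<close>. As Mini's edge was legal, this path has fewer than s
    vertices, which leaves Max free to claim any pair in this set.\<close>
  have card: "card (insert a B) < s"
  proof -
    obtain q where q: "set (b # q) = B" "is_path E (b # q)"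
      by (rule spanned_by_cycle_rotate[OF sp B(2)]) blast
    have "is_path ?F (b # q)" by (rule is_path_mono[OF q(2)]) auto
    then have "is_path ?F (a # b # q)"
      using q(1) aB by (auto simp: is_path_Cons[of _ a])
    then have "\<not> s \<le> length (a # b # q)" using contains_path_if_long v unfolding valid_def by blast
    moreover have "length (b # q) = card B" using is_path_length[OF q(2)] q(1) by simp
    ultimately show ?thesis using aB PB(3) by simp
  qed
  have "detached E (insert a B)" using detached_Un[OF Pa(1) PB(1)] by simp
  then have det: "detached ?F (insert a B)" using B(2) by (auto simp: detached_insert_iff)
  have vH: "valid s n ?H"
    by (rule valid_insert_within[OF v det]) (use x(1) Pa(2) PB(2) card aB in auto)
  have "{a, x} \<notin> ?F" using detachedD[OF Pa(1)] x(1,2) aB by (auto simp: doubleton_eq_iff)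
  then have legal: "{a, x} \<in> legal_moves s n ?F" using legal_moves_iff[OF v] vH by blast
  have "components_partition n ?F (merge \<D> {a} B)"
    by (rule components_partition_merge[OF p a _ B(1,2)]) simp
  then have pH: "components_partition n ?H (merge \<D> {a} B)"
    by (rule components_partition_insert[of _ _ _ "insert a B"]) (use x(1) in \<open>auto simp: merge_def\<close>)
  have "calm s n ?H (merge \<D> {a} B)" unfolding calm_def
  proof (intro conjI vH pH ballI impI)
    fix D assume D: "D \<in> merge \<D> {a} B" "card D \<noteq> 1"
    show "spanned_by_cycle ?H D"
    proof (cases "D = {a} \<union> B")
      case True
      then show ?thesis using x(3) by (simp add: insert_commute)
    next
      case False
      then have "spanned_by_cycle E D" using D calmD(3)[OF c] unfolding merge_def by blast
      then show ?thesis by (rule spanned_by_cycle_mono) auto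
    qed
  qed
  then show ?thesis using that legal by blast
qed

text \<open>Isolated edges feed the vertex with separated legs, triangles correct the parity, and
  cliques on s - 4 vertices settle the join of two single edges. For \<open>s = 7\<close> the last
  two sizes coincide.\<close>

definition supplied :: "nat \<Rightarrow> nat \<Rightarrow> nat set set \<Rightarrow> nat set set \<Rightarrow> bool" where
  "supplied s m E \<D> \<longleftrightarrow> (\<forall>r\<in>{2, 3, s - 4}. m \<le> card (cliques E \<D> r))"

lemma supplied_mono: "supplied s m E \<D> \<Longrightarrow> k \<le> m \<Longrightarrow> supplied s k E \<D>"
  unfolding supplied_def by (meson order_trans)

lemma supplied_step:
  assumes "supplied s (m + j) E \<D>" "components_partition n F \<D>'"
    and "\<And>r. r \<noteq> 1 \<Longrightarrow> cliques E \<D> r \<subseteq> cliques F \<D>' r \<union> X" "finite X" "card X \<le> j" "7 \<le> s"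
  shows "supplied s m F \<D>'"
  unfolding supplied_def
proof
  fix r assume r: "r \<in> {2, 3, s - 4}"
  have fin: "finite (cliques F \<D>' r)" by (rule finite_cliques[OF assms(2)])
  have "r \<noteq> 1" using r assms(6) by auto
  then have "card (cliques E \<D> r) \<le> card (cliques F \<D>' r \<union> X)"
    using assms(3)[of r] assms(4) fin by (intro card_mono) auto
  also have "\<dots> \<le> card (cliques F \<D>' r) + card X" by (rule card_Un_le)
  finally have "card (cliques E \<D> r) \<le> card (cliques F \<D>' r) + j" using assms(5) by simp
  moreover have "m + j \<le> card (cliques E \<D> r)" using assms(1) r unfolding supplied_def by blast
  ultimately show "m \<le> card (cliques F \<D>' r)" by simp
qed

lemma calm_filling:
  assumes "calm s n E \<D>" "singles \<D> = {}"
  shows "filling s n E \<D>"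
proof -
  have "spanned_by_cycle E D" if "D \<in> \<D>" for D
    using assms that calmD(3) unfolding singles_def by blast
  moreover have "\<not> contains_path s E" using calmD(1)[OF assms(1)] unfolding valid_def by blast
  ultimately show ?thesis
    using assms(1) spanned_by_cycle_thick spanned_by_cycle_card_less
    unfolding filling_def calm_def by blast
qed

text \<open>A lone isolated vertex cannot be paired, so Max hangs it on a triangle. The new part has
  no spanning cycle but is thick: from \<open>w\<close> one reaches \<open>x\<close> and a second
  vertex of the triangle. The resulting parity is irrelevant, since Max can correct it after Mini's
  move.\<close>

lemma last_single_wins:
  assumes c: "calm s n E \<D>" and w: "singles \<D> = {{w}}" and s: "7 \<le> s"
    and sup: "supplied s (4 * d + 12) E \<D>"
  shows "winning s n d Player_Max E"
proof -
  note v = calmD(1)[OF c] and p = calmD(2)[OF c]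
  have wD: "{w} \<in> \<D>" using w unfolding singles_def by auto
  have "cliques E \<D> 3 \<noteq> {}" using sup unfolding supplied_def by force
  then obtain C where C: "C \<in> \<D>" "card C = 3" "clique E C" unfolding cliques_def by blast
  note PC = components_partitionD[OF p C(1)] and Pw = components_partitionD[OF p wD]
  have wC: "w \<notin> C" using components_partition_unique[OF p wD C(1)] C(2) by force
  obtain x where x: "x \<in> C" using PC(4) by blast
  let ?F = "insert {x, w} E" and ?D = "merge \<D> C {w}"
  have vF: "valid s n ?F"
    by (rule valid_insert_within[OF v detached_Un[OF PC(1) Pw(1)]])
      (use x wC PC Pw C(2) s in auto)
  have "{x, w} \<notin> E" using detachedD[OF PC(1)] x wC by blast
  then have legal: "{x, w} \<in> legal_moves s n E" using legal_moves_iff[OF v] vF by blast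
  have pF: "components_partition n ?F ?D"
    by (rule components_partition_merge[OF p C(1) x wD]) simp
  have sp: "spanned_by_cycle E C" by (rule clique_spanned_by_cycle[OF C(3) PC(3)]) (use C(2) in simp)
  have "filling s n ?F ?D"
    unfolding filling_def
  proof (intro conjI vF pF ballI)
    fix D assume D: "D \<in> ?D"
    show "card D < s"
    proof (cases "D = C \<union> {w}")
      case True
      then show ?thesis using PC(3) wC C(2) s by simp
    next
      case False
      then have "D \<in> \<D>" "D \<noteq> {w}" using D unfolding merge_def by auto
      then have "spanned_by_cycle E D" using calmD(3)[OF c] w unfolding singles_def by auto
      then show ?thesis using spanned_by_cycle_card_less v unfolding valid_def by blast
    qed
    show "thick ?F D"
    proof (cases "D = C \<union> {w}")
      case True
      have "\<exists>q. leg 2 ?F u q \<and> set q \<subseteq> D" if u: "u \<in> D" for u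
      proof (cases "u = w")
        case False
        then have "u \<in> C" using u True by simp
        then obtain q where "leg 2 E u q" "set q \<subseteq> C - {u}"
          by (rule spanned_by_cycle_leg[OF sp, where l = 2]) (use C(2) in auto)
        then show ?thesis using leg_mono[of 2 E u q ?F] True by blast
      next
        case True
        obtain q where q: "leg 1 E x q" "set q \<subseteq> C - {x}"
          by (rule spanned_by_cycle_leg[OF sp x, where l = 1]) (use C(2) in auto)
        then have "is_path ?F (x # q)" using is_path_mono[of E "x # q" ?F] unfolding leg_def by blast
        then have "leg 2 ?F w (x # q)"
          using q x wC unfolding leg_def by (auto simp: is_path_Cons[of _ w] insert_commute)
        then show ?thesis using True \<open>D = C \<union> {w}\<close> q(2) x by (intro exI[of _ "x # q"]) auto
      qed
      then show ?thesis unfolding thick_def by blast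
    next
      case False
      then have "D \<in> \<D>" "D \<noteq> {w}" using D unfolding merge_def by auto
      then have "spanned_by_cycle E D" using calmD(3)[OF c] w unfolding singles_def by auto
      then show ?thesis using spanned_by_cycle_thick thick_mono[of E D ?F] by blast
    qed
  qed
  moreover have "supplied s (4 * d + 11) ?F ?D"
  proof (rule supplied_step[of s _ 1 E \<D> n _ _ "{C}"])
    show "cliques E \<D> r \<subseteq> cliques ?F ?D r \<union> {C}" if "r \<noteq> 1" for r
      using cliques_merge_single[of E ?F r \<D> w C] that by (auto simp: merge_commute)
  qed (use sup pF s in \<open>auto elim!: supplied_mono\<close>)
  ultimately have "winning s n d Player_Mini ?F"
    by (intro filling_wins_Mini[OF _ s]) (auto simp: supplied_def)
  then show ?thesis using legal winning.max_move by blast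
qed

text \<open>Each attack on a clique costs Mini an isolated vertex, so a surplus of cliques survives. Max
  answers an attack by restoring a spanning cycle.\<close>
lemma supplied_wins_Mini:
  assumes "calm s n E \<D>" "7 \<le> s" "supplied s (4 * d + 20 + card (singles \<D>)) E \<D>"
  shows "winning s n d Player_Mini E"
  using assms
proof (induction "card (complete_edges n - E)" arbitrary: E \<D> rule: less_induct)
  case less
  note c = less.prems(1) and s = less.prems(2) and sup = less.prems(3)
  note v = calmD(1)[OF c] and p = calmD(2)[OF c]
  have reply: "winning s n d Player_Max (insert e E)"
    if e: "e \<in> legal_moves s n E" and e': "e' \<in> legal_moves s n (insert e E)"
      and c': "calm s n (insert e' (insert e E)) \<D>'"
      and sup': "supplied s (4 * d + 20 + card (singles \<D>')) (insert e' (insert e E)) \<D>'" for e e' \<D>'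
  proof -
    have "complete_edges n - insert e' (insert e E) \<subset> complete_edges n - E"
      using e unfolding legal_moves_def by auto
    then have "card (complete_edges n - insert e' (insert e E)) < card (complete_edges n - E)"
      by (intro psubset_card_mono) auto
    then have "winning s n d Player_Mini (insert e' (insert e E))"
      using less.hyps c' s sup' by blast
    then show ?thesis using e' winning.max_move by blast
  qed
  show ?case
  proof (rule winning.mini_move)
    show "legal_moves s n E \<noteq> {}"
      by (rule legal_moves_nonempty[OF v])
        (use s sup card_cliques_le[OF p, of 2] in \<open>auto simp: supplied_def\<close>)
  next
    fix e assume e: "e \<in> legal_moves s n E"
    then have vF: "valid s n (insert e E)" using legal_moves_iff[OF v] by blast
    from c e show "winning s n d Player_Max (insert e E)"
    proof (cases rule: calm_move_cases)
      case (quiet \<D>')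
      let ?F = "insert e E"
      note pF = calmD(2)[OF quiet(1)]
      have le: "card (singles \<D>') \<le> card (singles \<D>)"
        by (rule card_mono[OF finite_singles[OF p] quiet(2)])
      have sub: "cliques E \<D> r \<subseteq> cliques ?F \<D>' r" if "r \<noteq> 1" for r
        by (rule cliques_large[OF _ quiet(4) that]) auto
      have supF: "supplied s (4 * d + 20 + card (singles \<D>)) ?F \<D>'"
        by (rule supplied_step[of s _ 0 E \<D> n _ _ "{}"]) (use sup pF sub s in auto)
      \<comment> \<open>The reply depends on the isolated vertices left: with none the parity
        argument starts, a single one is hung on a triangle, and two are paired with each
        other.\<close>
      consider "singles \<D>' = {}" | w where "singles \<D>' = {{w}}"
        | a b where "{a} \<in> \<D>'" "{b} \<in> \<D>'" "a \<noteq> b"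
      proof (cases "card (singles \<D>') \<le> Suc 0")
        case True
        show ?thesis
        proof (cases "singles \<D>' = {}")
          case False
          then obtain D where D: "D \<in> singles \<D>'" by blast
          then have "singles \<D>' = {D}"
            using True card_le_Suc0_iff_eq[OF finite_singles[OF pF]] by auto
          then show ?thesis using that(2) D by (elim singleE) auto
        qed (use that in blast)
      next
        case False
        then obtain A B where "A \<in> singles \<D>'" "B \<in> singles \<D>'" "A \<noteq> B"
          using card_le_Suc0_iff_eq[OF finite_singles[OF pF]] by metis
        then show ?thesis using that(3) by (elim singleE) auto
      qed
      then show ?thesis
      proof cases
        case 1
        have "supplied s (4 * d + 20) ?F \<D>'" using supF by (rule supplied_mono) simp
        then have "4 * d + 20 \<le> card (cliques ?F \<D>' r)" if "r \<in> {2, 3, s - 4}" for r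
          using that unfolding supplied_def by blast
        from this[of 2] this[of 3] this[of "s - 4"] show ?thesis
          by (intro filling_wins_Max[OF calm_filling[OF quiet(1) 1] s]) auto
      next
        case (2 w)
        then show ?thesis
          by (rule last_single_wins[OF quiet(1) _ s]) (rule supplied_mono[OF supF], simp)
      next
        case (3 a b)
        note m = calm_pair_singles[OF quiet(1) 3]
        have m1: "{a, b} \<in> legal_moves s n ?F" and m2: "calm s n (insert {a, b} ?F) (merge \<D>' {a} {b})"
          using m s by auto
        have ss: "singles (merge \<D>' {a} {b}) \<subseteq> singles \<D>'"
          using singles_merge[OF pF 3(1,2)] 3(3) by auto
        have le2: "card (singles (merge \<D>' {a} {b})) \<le> card (singles \<D>)"
          using card_mono[OF finite_singles[OF pF] ss] le by simp
        have "supplied s (4 * d + 20 + card (singles \<D>)) (insert {a, b} ?F) (merge \<D>' {a} {b})"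
        proof (rule supplied_step[of s _ 0 ?F \<D>' n _ _ "{}"])
          show "cliques ?F \<D>' r \<subseteq> cliques (insert {a, b} ?F) (merge \<D>' {a} {b}) r \<union> {}" 
            if "r \<noteq> 1" for r
            using cliques_merge_singles[of ?F "insert {a, b} ?F" r \<D>' a b] that by auto
        qed (use supF calmD(2)[OF m2] s in auto)
        then have "supplied s (4 * d + 20 + card (singles (merge \<D>' {a} {b}))) (insert {a, b} ?F)
            (merge \<D>' {a} {b})"
          by (rule supplied_mono) (use le2 in simp)
        then show ?thesis using reply[OF e m1 m2] by blast
      qed
    next
      case (joining A B a b)
      show ?thesis
      proof (cases "card A = 1")
        case False
        have "thick E A" "thick E B"
          using spanned_by_cycle_thick calmD(3)[OF c] joining False by blast+
        moreover have "4 * d + 20 \<le> card (cliques E \<D> r)" if "r \<in> {2, 3, s - 4}" for r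
          using that sup unfolding supplied_def by fastforce
        from this[of 2] this[of "s - 4"] have "4 * d + 8 \<le> card (cliques E \<D> 2)"
          "cliques E \<D> (s - 4) \<noteq> {}" by auto
        ultimately show ?thesis
          using join_thick_wins[of s n a b E \<D> A B d] vF p s joining by simp
      next
        case True
        then have A: "A = {a}" using joining(4) by (auto simp: card_1_singleton_iff)
        have aD: "{a} \<in> \<D>" using joining(1) A by simp
        obtain x where x: "{a, x} \<in> legal_moves s n (insert {a, b} E)"
          "calm s n (insert {a, x} (insert {a, b} E)) (merge \<D> {a} B)"
          by (rule calm_close_pendant[OF c aD joining(2,5,7)]) (use vF joining(6) in auto)
        let ?H = "insert {a, x} (insert {a, b} E)" and ?D = "merge \<D> {a} B"
        have "singles ?D = singles \<D> - {{a}}"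
          using singles_merge[OF p aD joining(2)] joining(3,7) A unfolding singles_def by auto
        moreover have "{a} \<in> singles \<D>" using aD unfolding singles_def by simp
        ultimately have k: "card (singles \<D>) = card (singles ?D) + 1"
          using card.remove[OF finite_singles[OF p]] by simp
        have "supplied s (4 * d + 20 + card (singles ?D)) ?H ?D"
        proof (rule supplied_step[of s _ 1 E \<D> n _ _ "{B}"])
          show "cliques E \<D> r \<subseteq> cliques ?H ?D r \<union> {B}" if "r \<noteq> 1" for r
            using cliques_merge_single[of E ?H r \<D> a B] that by auto
        qed (use sup k calmD(2)[OF x(2)] s in \<open>auto elim!: supplied_mono\<close>)
        then show ?thesis using reply[of e "{a, x}" ?D] e x joining(6) by simp
      qed
    qed
  qed
qed

section \<open>Stockpiling cliques\<close>

lemma two_singles: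
  assumes "components_partition n E \<D>" "2 \<le> card (singles \<D>)"
  obtains a b where "{a} \<in> \<D>" "{b} \<in> \<D>" "a \<noteq> b"
proof -
  have "\<not> card (singles \<D>) \<le> Suc 0" using assms(2) by simp
  then obtain A B where "A \<in> singles \<D>" "B \<in> singles \<D>" "A \<noteq> B"
    using card_le_Suc0_iff_eq[OF finite_singles[OF assms(1)]] by metis
  then show ?thesis using that by (elim singleE) auto
qed

lemma split_legs_one_wins:
  assumes "valid s n E" "split_legs 1 E c" "4 * d \<le> card (clique_components n E 1)" "7 \<le> s"
  shows "winning s n d Player_Max E"
proof -
  obtain p where "leg 1 E c p" using assms(2) unfolding split_legs_def by blast
  then have p: "length p = 1" "is_path E (c # p)" unfolding leg_def by auto
  then obtain x where "p = [x]" by (auto simp: length_Suc_conv)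
  then have "{c, x} \<in> E" using p(2) by (simp add: is_path_Cons)
  then have "c < n" using valid_edge[OF assms(1)] by blast
  then show ?thesis using split_legs_wins[OF assms(1,2) _ _ _ assms(3)] assms(4) by simp
qed

lemma leg_one: "leg 1 E c [x] \<longleftrightarrow> c \<noteq> x \<and> {c, x} \<in> E"
  unfolding leg_def by (auto simp: is_path_Cons)

text \<open>While isolated vertices abound, legs of one vertex are enough. Joining a part
  \<open>B\<close> with a spanning cycle to anything gives \<open>b\<close> one leg in
  \<open>B\<close> and one across the new edge, so only quiet moves need a continuation. The
  hypothesis \<open>cont\<close> ranges over all positions that these lead to; in this form the
  stages of the strategy can be chained.\<close>

lemma calm_wins_Mini:
  assumes c: "calm s n E \<D>" and s: "7 \<le> s" and k: "4 * d + 2 \<le> card (singles \<D>)"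
    and cont: "\<And>E' \<D>'. calm s n E' \<D>' \<Longrightarrow> E \<subseteq> E' \<Longrightarrow> \<D> - singles \<D> \<subseteq> \<D>' \<Longrightarrow>
      card (singles \<D>) \<le> card (singles \<D>') + 2 \<Longrightarrow> card (singles \<D>') \<le> card (singles \<D>) \<Longrightarrow>
      winning s n d Player_Max E'"
  shows "winning s n d Player_Mini E"
proof (rule winning.mini_move)
  note v = calmD(1)[OF c] and p = calmD(2)[OF c]
  obtain a b where ab: "{a} \<in> \<D>" "{b} \<in> \<D>" "a \<noteq> b"
    by (rule two_singles[OF p]) (use k in simp)
  show "legal_moves s n E \<noteq> {}" using calm_pair_singles(1)[OF c ab] s by auto
next
  fix e assume e: "e \<in> legal_moves s n E"
  note v = calmD(1)[OF c] and p = calmD(2)[OF c]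
  have vF: "valid s n (insert e E)" using e legal_moves_iff[OF v] by blast
  from c e show "winning s n d Player_Max (insert e E)"
  proof (cases rule: calm_move_cases)
    case (quiet \<D>')
    have "card (singles \<D>') \<le> card (singles \<D>)"
      by (rule card_mono[OF finite_singles[OF p] quiet(2)])
    then show ?thesis using cont quiet by blast
  next
    case (joining A B a b)
    have disj: "A \<inter> B = {}" using components_partition_unique[OF p joining(1,2)] joining(3) by blast
    have sp: "spanned_by_cycle E B" using calmD(3)[OF c] joining(2,7) by blast
    obtain q where q: "leg 1 E b q" "set q \<subseteq> B - {b}"
      by (rule spanned_by_cycle_leg[OF sp joining(5), where l = 1])
        (use spanned_by_cycle_card[OF sp] in auto)
    have "split_legs 1 (insert {b, a} E) b"
    proof (rule split_legs_join[OF components_partitionD(1)[OF p joining(1)] _ joining(4) _ q(1)])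
      show "leg (1 - 1) E a []" by (simp add: leg_def is_path_Cons)
    qed (use disj joining q in auto)
    then have "split_legs 1 (insert e E) b" using joining(6) by (simp add: insert_commute)
    moreover have "card (clique_components n E 1) \<le> card (clique_components n (insert e E) 1) + 2"
      unfolding joining(6) by (rule card_clique_components_insert)
    ultimately show ?thesis
      using split_legs_one_wins[OF vF] k card_singles_le[OF p] s by simp
  qed
qed

text \<open>Every round claims at least one missing pair of \<open>C\<close> and costs at most two
  isolated vertices, which Mini may pair in reply.\<close>

lemma fill_component:
  assumes "calm s n E \<D>" "7 \<le> s" "C \<in> \<D>" "card C \<noteq> 1"
    and "4 * d + 2 * card (missing n E {C}) \<le> card (singles \<D>)"
    and "\<And>E' \<D>'. calm s n E' \<D>' \<Longrightarrow> E \<subseteq> E' \<Longrightarrow> \<D> - singles \<D> \<subseteq> \<D>' \<Longrightarrow> clique E' C \<Longrightarrow>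
      card (singles \<D>) \<le> card (singles \<D>') + 2 * card (missing n E {C}) \<Longrightarrow>
      winning s n d Player_Max E'"
  shows "winning s n d Player_Max E"
  using assms
proof (induction "card (missing n E {C})" arbitrary: E \<D> rule: less_induct)
  case less
  note c = less.prems(1) and s = less.prems(2) and C = less.prems(3,4)
  note v = calmD(1)[OF c] and p = calmD(2)[OF c]
  note PC = components_partitionD[OF p C(1)]
  show ?case
  proof (cases "missing n E {C} = {}")
    case True
    have "{x, y} \<in> E" if "x \<in> C" "y \<in> C" "x \<noteq> y" for x y
    proof (rule ccontr)
      assume "{x, y} \<notin> E"
      then have "{x, y} \<in> missing n E {C}" using that PC(2) unfolding missing_def by auto
      then show False using True by blast
    qed
    then have "clique E C" unfolding clique_def by blast
    then show ?thesis using less.prems(6)[OF c] by simp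
  next
    case False
    then obtain e where e: "e \<in> complete_edges n" "e \<notin> E" "e \<subseteq> C" unfolding missing_def by auto
    obtain a b where ab: "e = {a, b}" "a \<noteq> b" using e(1) complete_edgesE by metis
    have cardC: "card C < s"
      using spanned_by_cycle_card_less calmD(3)[OF c C] v unfolding valid_def by blast
    have vF: "valid s n (insert {a, b} E)"
      by (rule valid_insert_within[OF v PC(1)]) (use e(3) ab PC(2) cardC in auto)
    then have legal: "e \<in> legal_moves s n E" using legal_moves_iff[OF v] e(2) ab(1) by simp
    have cF: "calm s n (insert e E) \<D>"
      unfolding ab(1) by (rule calm_insert_inside[OF c C(1) _ _ vF]) (use e(3) ab(1) in auto)
    have "e \<in> missing n E {C}" using e unfolding missing_def by simp
    then have pos: "1 \<le> card (missing n E {C})" by (metis One_nat_def Suc_leI card_gt_0_iff empty_iff finite_missing)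
    have "winning s n d Player_Mini (insert e E)"
    proof (rule calm_wins_Mini[OF cF s])
      show "4 * d + 2 \<le> card (singles \<D>)" using less.prems(5) pos by simp
    next
      fix E' \<D>'
      assume E': "calm s n E' \<D>'" "insert e E \<subseteq> E'" "\<D> - singles \<D> \<subseteq> \<D>'"
        "card (singles \<D>) \<le> card (singles \<D>') + 2" 
      have "missing n E' {C} \<subset> missing n E {C}"
        using E'(2) e unfolding missing_def by auto
      then have less_m: "card (missing n E' {C}) < card (missing n E {C})"
        by (intro psubset_card_mono) auto
      have CD: "C \<in> \<D>'" using E'(3) C unfolding singles_def by auto
      have big: "4 * d + 2 * card (missing n E' {C}) \<le> card (singles \<D>')"
        using less_m E'(4) less.prems(5) by simp
      show "winning s n d Player_Max E'"
      proof (rule less.hyps[OF less_m E'(1) s CD C(2) big])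
        fix E'' \<D>''
        assume E'': "calm s n E'' \<D>''" "E' \<subseteq> E''" "\<D>' - singles \<D>' \<subseteq> \<D>''" "clique E'' C"
          "card (singles \<D>') \<le> card (singles \<D>'') + 2 * card (missing n E' {C})"
        have "\<D> - singles \<D> \<subseteq> \<D>''" using E'(3) E''(3) unfolding singles_def by blast
        moreover have "card (singles \<D>) \<le> card (singles \<D>'') + 2 * card (missing n E {C})"
          using E'(4) E''(5) less_m by simp
        ultimately show "winning s n d Player_Max E''"
          using less.prems(6)[OF E''(1)] E'(2) E''(2,4) by blast
      qed
    qed
    then show ?thesis using legal winning.max_move by blast
  qed
qed

text \<open>Max hangs \<open>w\<close> on \<open>u\<close>, which then has the legs \<open>w\<close>
  and \<open>x\<close>. Unless Mini joins \<open>w\<close> to a second vertex of \<open>C\<close>,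
  deleting \<open>u\<close> separates them. That one reply closes a spanning cycle, and the
  remaining pairs are filled in. The cost is \<open>w\<close> itself and two isolated vertices for
  each of at most \<open>card C\<close> pairs, which is at most \<open>2 * s\<close>.\<close>

lemma grow_clique:
  assumes c: "calm s n E \<D>" and s: "7 \<le> s" and C: "C \<in> \<D>" "clique E C" "2 \<le> card C" "card C + 1 < s"
    and k: "4 * d + 2 * s + 3 \<le> card (singles \<D>)"
    and cont: "\<And>E' \<D>' C'. calm s n E' \<D>' \<Longrightarrow> E \<subseteq> E' \<Longrightarrow> \<D> - singles \<D> - {C} \<subseteq> \<D>' \<Longrightarrow>
      C' \<in> \<D>' \<Longrightarrow> C' \<notin> \<D> \<Longrightarrow> card C' = card C + 1 \<Longrightarrow> clique E' C' \<Longrightarrow>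
      card (singles \<D>) \<le> card (singles \<D>') + 2 * s \<Longrightarrow> winning s n d Player_Max E'"
  shows "winning s n d Player_Max E"
proof -
  note v = calmD(1)[OF c] and p = calmD(2)[OF c]
  note PC = components_partitionD[OF p C(1)]
  obtain w w' where "{w} \<in> \<D>" "{w'} \<in> \<D>" "w \<noteq> w'" by (rule two_singles[OF p]) (use k s in auto)
  then have w: "{w} \<in> \<D>" by blast
  note Pw = components_partitionD[OF p w]
  have neC: "{w} \<noteq> C" using C(3) by auto
  then have wC: "w \<notin> C" using components_partition_unique[OF p w C(1)] by blast
  obtain u x where ux: "u \<in> C" "x \<in> C" "u \<noteq> x"
  proof -
    have "\<not> card C \<le> Suc 0" using C(3) by simp
    then show ?thesis using that card_le_Suc0_iff_eq[OF PC(3)] by blast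
  qed
  let ?C = "insert w C" and ?F = "insert {u, w} E"
  have cardC: "card ?C = card C + 1" using wC PC(3) by simp
  have det: "detached E ?C" using detached_Un[OF Pw(1) PC(1)] by simp
  have detF: "detached ?F ?C" using det ux(1) by (auto simp: detached_insert_iff)
  have Cn: "?C \<subseteq> {..<n}" using Pw(2) PC(2) by simp
  have within: "valid s n (insert {y, z} G)" if "valid s n G" "detached G ?C" "y \<in> ?C" "z \<in> ?C" "y \<noteq> z"
    for y z G
    by (rule valid_insert_within[OF that(1,2)]) (use that Cn cardC C(4) in auto)
  have vF: "valid s n ?F" by (rule within[OF v det]) (use ux(1) wC in auto)
  have "{u, w} \<notin> E" using detachedD[OF PC(1)] ux(1) wC by blast
  then have legal: "{u, w} \<in> legal_moves s n E" using legal_moves_iff[OF v] vF by blast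
  have wE: "{w, z} \<notin> E" for z
    using detachedD[OF Pw(1), of w z] valid_edge[OF v, of w z] by auto
  have "winning s n d Player_Mini ?F"
  proof (rule winning.mini_move)
    have "{w, x} \<notin> ?F" using wE ux wC by (auto simp: doubleton_eq_iff)
    moreover have "valid s n (insert {w, x} ?F)" by (rule within[OF vF detF]) (use ux(2) wC in auto)
    ultimately have "{w, x} \<in> legal_moves s n ?F" by (simp only: legal_moves_iff[OF vF] simp_thms)
    then show "legal_moves s n ?F \<noteq> {}" by (metis empty_iff)
  next
    fix e assume e: "e \<in> legal_moves s n ?F"
    let ?H = "insert e ?F"
    have e': "e \<notin> ?F" "valid s n ?H" "e \<in> complete_edges n"
      using e legal_moves_iff[OF vF] unfolding legal_moves_def by auto
    obtain y z where yz: "e = {y, z}" using e'(3) complete_edgesE by metis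
    have "card (clique_components n E 1) \<le> card (clique_components n ?F 1) + 2"
      by (rule card_clique_components_insert)
    moreover have "card (clique_components n ?F 1) \<le> card (clique_components n ?H 1) + 2"
      unfolding yz by (rule card_clique_components_insert)
    ultimately have fodder: "4 * d \<le> card (clique_components n ?H 1)"
      using k s card_singles_le[OF p] by simp
    have legs: "leg 1 ?H u [w]" "leg 1 ?H u [x]"
      using ux wC C(2) unfolding leg_one clique_def by auto
    consider (off) "w \<notin> e" | (away) y where "e = {w, y}" "y \<notin> C"
      | (closed) y where "e = {w, y}" "y \<in> C" "y \<noteq> u"
    proof (cases "w \<in> e")
      case True
      then obtain y where y: "e = {w, y}" using yz by auto
      have "y \<noteq> u" using y e'(1) by (auto simp: insert_commute)
      then show ?thesis using that y by blast
    qed (use that in blast)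
    then show "winning s n d Player_Max ?H"
    proof cases
      case off
      have "detached (delete_vertex u ?H) {w}"
        using Pw(1) off unfolding detached_def delete_vertex_def by auto
      then have "split_legs 1 ?H u" unfolding split_legs_def
        using legs ux wC by (intro exI[of _ "{w}"] exI[of _ "[w]"] exI[of _ "[x]"]) auto
      then show ?thesis using split_legs_one_wins[OF e'(2)] fodder s by blast
    next
      case (away y)
      have "detached (delete_vertex u E) (C - {u})"
        using PC(1) unfolding detached_def delete_vertex_def by blast
      then have "detached (delete_vertex u ?H) (C - {u})"
        using away wC unfolding delete_vertex_insert by (auto simp: detached_insert_iff)
      then have "split_legs 1 ?H u" unfolding split_legs_def
        using legs ux wC by (intro exI[of _ "C - {u}"] exI[of _ "[x]"] exI[of _ "[w]"]) auto
      then show ?thesis using split_legs_one_wins[OF e'(2)] fodder s by blast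
    next
      case (closed y)
      let ?D = "merge \<D> C {w}"
      have Ceq: "C \<union> {w} = ?C" by simp
      have "components_partition n ?F ?D"
        by (rule components_partition_merge[OF p C(1) ux(1) w]) simp
      then have pH: "components_partition n ?H ?D"
        unfolding closed(1)
        by (rule components_partition_insert[of _ _ _ ?C]) (use closed in \<open>auto simp: merge_def\<close>)
      have "finite (C - {u, y})" using PC(3) by simp
      then obtain m where m: "set m = C - {u, y}" "distinct m" using finite_distinct_list by metis
      have "is_path E (y # m @ [u])"
        by (rule clique_is_path[OF C(2)]) (use m closed(2,3) ux(1) in auto)
      then have "is_path ?H (y # m @ [u])" by (rule is_path_mono) auto
      then have "is_path ?H (w # y # m @ [u])"
        using m wC ux(1) closed by (auto simp: is_path_Cons[of _ w])
      then have spC: "spanned_by_cycle ?H ?C" unfolding spanned_by_cycle_def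
        using m ux(1) closed by (intro exI[of _ "w # y # m @ [u]"]) auto
      have cH: "calm s n ?H ?D" unfolding calm_def
      proof (intro conjI pH e'(2) ballI impI)
        fix D assume D: "D \<in> ?D" "card D \<noteq> 1"
        show "spanned_by_cycle ?H D"
        proof (cases "D = ?C")
          case False
          then have "spanned_by_cycle E D" using D calmD(3)[OF c] unfolding merge_def by auto
          then show ?thesis by (rule spanned_by_cycle_mono) auto
        qed (use spC in simp)
      qed
      have "singles ?D = singles \<D> - {C, {w}}"
        by (rule singles_merge[OF p C(1) w]) (use neC in simp)
      then have "singles ?D = singles \<D> - {{w}}" using C(3) unfolding singles_def by auto
      moreover have "{w} \<in> singles \<D>" using w unfolding singles_def by simp
      ultimately have sing: "card (singles \<D>) = card (singles ?D) + 1"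
        using card.remove[OF finite_singles[OF p]] by simp
      \<comment> \<open>Since \<open>C\<close> was a clique, only pairs at \<open>w\<close> can be
        missing.\<close>
      have "missing n ?H {?C} \<subseteq> (\<lambda>z. {w, z}) ` C"
      proof
        fix e0 assume "e0 \<in> missing n ?H {?C}"
        then have e0: "e0 \<in> complete_edges n" "e0 \<notin> E" "e0 \<subseteq> ?C" unfolding missing_def by auto
        then obtain i j where ij: "e0 = {i, j}" "i \<noteq> j" using complete_edgesE by metis
        then have "\<not> (i \<in> C \<and> j \<in> C)" using e0(2) C(2) unfolding clique_def by blast
        then show "e0 \<in> (\<lambda>z. {w, z}) ` C" using e0(3) ij by auto
      qed
      then have miss: "card (missing n ?H {?C}) \<le> card C"
        by (rule surj_card_le[OF PC(3)])
      have CD: "?C \<in> ?D" "card ?C \<noteq> 1" using C(3) cardC unfolding merge_def by auto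
      have large: "4 * d + 2 * card (missing n ?H {?C}) \<le> card (singles ?D)"
        using miss C(4) k sing by simp
      show ?thesis
      proof (rule fill_component[OF cH s CD large])
        fix E' \<D>'
        assume E': "calm s n E' \<D>'" "?H \<subseteq> E'" "?D - singles ?D \<subseteq> \<D>'" "clique E' ?C"
          "card (singles ?D) \<le> card (singles \<D>') + 2 * card (missing n ?H {?C})"
        show "winning s n d Player_Max E'"
        proof (rule cont[of E' \<D>' ?C, OF E'(1) _ _ _ _ cardC E'(4)])
          show "?C \<in> \<D>'" using CD E'(3) unfolding singles_def by blast
          show "?C \<notin> \<D>" using components_partition_unique[OF p w, of ?C w] ux(1) wC by auto
          have "D \<in> ?D - singles ?D" if "D \<in> \<D> - singles \<D> - {C}" for D
            using that unfolding merge_def singles_def by auto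
          then show "\<D> - singles \<D> - {C} \<subseteq> \<D>'" using E'(3) by blast
          show "card (singles \<D>) \<le> card (singles \<D>') + 2 * s" using E'(5) sing miss C(4) by simp
        qed (use E'(2) in auto)
      qed
    qed
  qed
  then show ?thesis using legal winning.max_move by blast
qed

text \<open>\<open>S\<close> is the stock built so far. It consists of parts with more than one
  vertex, which quiet moves leave in the partition, and their edges are all claimed already.\<close>

definition kept :: "nat set set \<Rightarrow> nat set set \<Rightarrow> nat set set \<Rightarrow> bool" where
  "kept E \<D> S \<longleftrightarrow> S \<subseteq> {D \<in> \<D>. card D \<noteq> 1 \<and> clique E D}"

text \<open>A pair of isolated vertices is enlarged one vertex at a time. The pair and Mini's reply
  to it cost at most four isolated vertices, each enlargement at most \<open>2 * s\<close>.\<close>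

lemma build_clique:
  assumes "calm s n E \<D>" "7 \<le> s" "kept E \<D> S" "2 \<le> r" "r < s"
    and "4 * d + 2 * s * r + 3 \<le> card (singles \<D>)"
    and "\<And>E' \<D>' C. calm s n E' \<D>' \<Longrightarrow> kept E' \<D>' (insert C S) \<Longrightarrow> C \<notin> S \<Longrightarrow> card C = r \<Longrightarrow>
      card (singles \<D>) \<le> card (singles \<D>') + 2 * s * r \<Longrightarrow> winning s n d Player_Max E'"
  shows "winning s n d Player_Max E"
  using assms(4-7)
proof (induction r rule: dec_induct)
  case base
  note c = assms(1) and s = assms(2)
  note p = calmD(2)[OF c]
  have s4: "14 \<le> 2 * s" using s by simp
  obtain a b where ab: "{a} \<in> \<D>" "{b} \<in> \<D>" "a \<noteq> b"
    by (rule two_singles[OF p]) (use base(2) s in auto)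
  have m: "{a, b} \<in> legal_moves s n E" "calm s n (insert {a, b} E) (merge \<D> {a} {b})"
    using calm_pair_singles[OF c ab] s by auto
  let ?F = "insert {a, b} E" and ?D = "merge \<D> {a} {b}"
  have "singles ?D = singles \<D> - {{a}, {b}}" by (rule singles_merge[OF p ab(1,2)]) (use ab(3) in simp)
  moreover have "card (singles \<D>) - card {{a}, {b}} \<le> card (singles \<D> - {{a}, {b}})"
    by (rule diff_card_le_card_Diff) simp
  moreover have "card {{a}, {b}} = 2" using ab(3) by simp
  ultimately have sing: "card (singles \<D>) \<le> card (singles ?D) + 2" by simp
  have "winning s n d Player_Mini ?F"
  proof (rule calm_wins_Mini[OF m(2) s])
    show "4 * d + 2 \<le> card (singles ?D)" using sing base(2) s by simp
  next
    fix E' \<D>'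
    assume E': "calm s n E' \<D>'" "?F \<subseteq> E'" "?D - singles ?D \<subseteq> \<D>'"
      "card (singles ?D) \<le> card (singles \<D>') + 2"
    have S: "S \<subseteq> \<D>" "\<And>D. D \<in> S \<Longrightarrow> card D \<noteq> 1 \<and> clique E D" using assms(3) unfolding kept_def by auto
    have notS: "{a, b} \<notin> S"
      using components_partition_unique[OF p ab(1), of "{a, b}" a] S(1) ab(3) by auto
    have new: "{a, b} \<in> ?D - singles ?D" using ab(3) unfolding merge_def singles_def by auto
    have "D \<in> ?D - singles ?D" if "D \<in> S" for D
    proof -
      have "card D \<noteq> 1" "D \<in> \<D>" using S that by auto
      moreover from this have "D \<noteq> {a}" "D \<noteq> {b}" by auto
      ultimately show ?thesis unfolding merge_def singles_def by simp
    qed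
    then have sub: "insert {a, b} S \<subseteq> \<D>'" using new E'(3) by blast
    moreover have "clique E' {a, b}" using E'(2) unfolding clique_def by (auto simp: insert_commute)
    moreover have "clique E' D" if "D \<in> S" for D using S(2)[OF that] clique_mono[of E D E'] E'(2) by blast
    ultimately have "kept E' \<D>' (insert {a, b} S)"
      using S(2) ab(3) unfolding kept_def by auto
    then show "winning s n d Player_Max E'"
      using base(3)[OF E'(1), of "{a, b}"] notS ab(3) sing E'(4) s4 by simp
  qed
  then show ?case using m(1) winning.max_move by blast
next
  case (step r)
  have le: "2 * s * r + 2 * s = 2 * s * Suc r" by simp
  show ?case
  proof (rule step.IH)
    show "4 * d + 2 * s * r + 3 \<le> card (singles \<D>)" "r < s" using step.prems(1,2) le by auto
  next
    fix E' \<D>' C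
    assume E': "calm s n E' \<D>'" "kept E' \<D>' (insert C S)" "C \<notin> S" "card C = r"
      "card (singles \<D>) \<le> card (singles \<D>') + 2 * s * r"
    have C: "C \<in> \<D>'" "clique E' C" and S: "\<And>D. D \<in> S \<Longrightarrow> D \<in> \<D>' \<and> card D \<noteq> 1 \<and> clique E' D"
      using E'(2) unfolding kept_def by auto
    show "winning s n d Player_Max E'"
    proof (rule grow_clique[OF E'(1) assms(2) C])
      show "4 * d + 2 * s + 3 \<le> card (singles \<D>')" using step.prems(2) E'(5) le by linarith
    next
      fix E'' \<D>'' C'
      assume E'': "calm s n E'' \<D>''" "E' \<subseteq> E''" "\<D>' - singles \<D>' - {C} \<subseteq> \<D>''" "C' \<in> \<D>''" "C' \<notin> \<D>'"
        "card C' = card C + 1" "clique E'' C'" "card (singles \<D>') \<le> card (singles \<D>'') + 2 * s"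
      have "D \<in> \<D>'' \<and> card D \<noteq> 1 \<and> clique E'' D" if "D \<in> S" for D
        using S[OF that] E''(3) E'(3) that clique_mono[of E' D E''] E''(2) unfolding singles_def by blast
      then have "kept E'' \<D>'' (insert C' S)"
        using E''(4,6,7) E'(4) step.hyps(1) unfolding kept_def by auto
      moreover have "C' \<notin> S" using S E''(5) by blast
      moreover have "card (singles \<D>) \<le> card (singles \<D>'') + 2 * s * Suc r"
        using E'(5) E''(8) le by linarith
      ultimately show "winning s n d Player_Max E''"
        using step.prems(3)[OF E''(1), of C'] E''(6) E'(4) by simp
    qed (use E'(4) step.hyps step.prems(1) in auto)
  qed
qed

lemma build_cliques:
  assumes "calm s n E \<D>" "7 \<le> s" "kept E \<D> S" "2 \<le> r" "r < s"
    and "4 * d + 2 * s * s * N + 3 \<le> card (singles \<D>)"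
    and "\<And>E' \<D>' T. calm s n E' \<D>' \<Longrightarrow> kept E' \<D>' (S \<union> T) \<Longrightarrow> S \<inter> T = {} \<Longrightarrow> card T = N \<Longrightarrow>
      (\<forall>D\<in>T. card D = r) \<Longrightarrow> card (singles \<D>) \<le> card (singles \<D>') + 2 * s * s * N \<Longrightarrow>
      winning s n d Player_Max E'"
  shows "winning s n d Player_Max E"
  using assms(1,3,6,7)
proof (induction N arbitrary: E \<D> S)
  case 0
  show ?case using 0(4)[OF 0(1), of "{}"] 0(2) by simp
next
  case (Suc N)
  have le: "2 * s * s * Suc N = 2 * s * s * N + 2 * s * s" by simp
  have sr: "2 * s * r \<le> 2 * s * s" using assms(5) by simp
  have b: "4 * d + 2 * s * r + 3 \<le> card (singles \<D>)" using Suc.prems(3) le sr by linarith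
  show ?case
  proof (rule build_clique[OF Suc.prems(1) assms(2) Suc.prems(2) assms(4,5) b])
    fix E' \<D>' C
    assume E': "calm s n E' \<D>'" "kept E' \<D>' (insert C S)" "C \<notin> S" "card C = r"
      "card (singles \<D>) \<le> card (singles \<D>') + 2 * s * r"
    have b': "4 * d + 2 * s * s * N + 3 \<le> card (singles \<D>')"
      using Suc.prems(3) E'(5) le sr by linarith
    show "winning s n d Player_Max E'"
    proof (rule Suc.IH[OF E'(1,2) b'])
      fix E'' \<D>'' T
      assume E'': "calm s n E'' \<D>''" "kept E'' \<D>'' (insert C S \<union> T)" "insert C S \<inter> T = {}"
        "card T = N" "\<forall>D\<in>T. card D = r" "card (singles \<D>') \<le> card (singles \<D>'') + 2 * s * s * N"
      have "finite \<D>''" using components_partition_finite calmD(2)[OF E''(1)] by blast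
      moreover have "T \<subseteq> \<D>''" using E''(2) unfolding kept_def by auto
      ultimately have "finite T" using finite_subset by blast
      moreover have "C \<notin> T" using E''(3) by blast
      ultimately have "card (insert C T) = Suc N" using E''(4) by simp
      moreover have "S \<union> insert C T = insert C S \<union> T" "S \<inter> insert C T = {}" using E''(3) E'(3) by auto
      moreover have "card (singles \<D>) \<le> card (singles \<D>'') + 2 * s * s * Suc N"
        using E'(5) E''(6) le sr by linarith
      ultimately show "winning s n d Player_Max E''"
        using Suc.prems(4)[OF E''(1), of "insert C T"] E''(2,5) E'(4) by simp
    qed
  qed
qed

text \<open>Max uses up isolated vertices in pairs until at most \<open>4 * d + 20\<close> are left.
  Up to then they punish every join by Mini; afterwards the stock outnumbers them as
  \<open>supplied_wins_Mini\<close> demands, because \<open>8 * d + 40\<close> is twice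
  \<open>4 * d + 20\<close>.\<close>

lemma supplied_wins_Max:
  assumes "calm s n E \<D>" "7 \<le> s" "supplied s (8 * d + 40) E \<D>" "2 \<le> card (singles \<D>)"
  shows "winning s n d Player_Max E"
  using assms
proof (induction "card (singles \<D>)" arbitrary: E \<D> rule: less_induct)
  case less
  note c = less.prems(1) and s = less.prems(2) and sup = less.prems(3)
  note p = calmD(2)[OF c]
  obtain a b where ab: "{a} \<in> \<D>" "{b} \<in> \<D>" "a \<noteq> b" by (rule two_singles[OF p less.prems(4)])
  let ?F = "insert {a, b} E" and ?D = "merge \<D> {a} {b}"
  have m: "{a, b} \<in> legal_moves s n E" and cF: "calm s n ?F ?D"
    using calm_pair_singles[OF c ab] s by auto
  have eq: "singles ?D = singles \<D> - {{a}, {b}}"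
    by (rule singles_merge[OF p ab(1,2)]) (use ab(3) in simp)
  moreover have in2: "{{a}, {b}} \<subseteq> singles \<D>" using ab unfolding singles_def by auto
  moreover have "card {{a}, {b}} = 2" using ab(3) by simp
  ultimately have sing: "card (singles ?D) = card (singles \<D>) - 2"
    using card_Diff_subset[of "{{a}, {b}}" "singles \<D>"] by simp
  have supF: "supplied s (8 * d + 40) ?F ?D"
  proof (rule supplied_step[of s _ 0 E \<D> n _ _ "{}"])
    show "cliques E \<D> r \<subseteq> cliques ?F ?D r \<union> {}" if "r \<noteq> 1" for r
      using cliques_merge_singles[of E ?F r \<D> a b] that by auto
  qed (use sup calmD(2)[OF cF] s in auto)
  have "winning s n d Player_Mini ?F"
  proof (cases "card (singles ?D) \<le> 4 * d + 20")
    case True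
    have "supplied s (4 * d + 20 + card (singles ?D)) ?F ?D"
      using supF by (rule supplied_mono) (use True in simp)
    then show ?thesis using supplied_wins_Mini[OF cF s] by blast
  next
    case False
    show ?thesis
    proof (rule calm_wins_Mini[OF cF s])
      show "4 * d + 2 \<le> card (singles ?D)" using False by simp
    next
      fix E' \<D>'
      assume E': "calm s n E' \<D>'" "?F \<subseteq> E'" "?D - singles ?D \<subseteq> \<D>'"
        "card (singles ?D) \<le> card (singles \<D>') + 2" "card (singles \<D>') \<le> card (singles ?D)"
      show "winning s n d Player_Max E'"
      proof (rule less.hyps[OF _ E'(1) s])
        show "card (singles \<D>') < card (singles \<D>)" using E'(5) sing less.prems(4) by simp
        show "2 \<le> card (singles \<D>')" using E'(4) False by simp
        show "supplied s (8 * d + 40) E' \<D>'"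
        proof (rule supplied_step[of s _ 0 ?F ?D n _ _ "{}"])
          show "cliques ?F ?D r \<subseteq> cliques E' \<D>' r \<union> {}" if "r \<noteq> 1" for r
            using cliques_large[OF E'(2,3) that] by simp
        qed (use supF calmD(2)[OF E'(1)] s in auto)
      qed
    qed
  qed
  then show ?case using m winning.max_move by blast
qed

lemma calm_wins_Max:
  assumes c: "calm s n E \<D>" and s: "7 \<le> s"
    and k: "4 * d + 6 * s * s * (8 * d + 40) + 5 \<le> card (singles \<D>)"
  shows "winning s n d Player_Max E"
proof -
  \<comment> \<open>\<open>N\<close> is the stock needed of each of the three sizes, and
    \<open>M\<close> bounds the isolated vertices spent on one size.\<close>
  define N where "N = 8 * d + 40"
  define M where "M = 2 * s * s * N"
  have k: "4 * d + 3 * M + 5 \<le> card (singles \<D>)" using k unfolding M_def N_def by simp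
  have fold: "2 * s * s * N = M" by (simp add: M_def)
  have "kept E \<D> {}" unfolding kept_def by simp
  then show ?thesis
  proof (rule build_cliques[OF c s, of _ "s - 4" d N, unfolded fold])
    fix E1 \<D>1 T1
    assume 1: "calm s n E1 \<D>1" "kept E1 \<D>1 ({} \<union> T1)" "card T1 = N" "\<forall>D\<in>T1. card D = s - 4"
      "card (singles \<D>) \<le> card (singles \<D>1) + M"
    show "winning s n d Player_Max E1"
    proof (rule build_cliques[OF 1(1) s 1(2), of 3 d N, unfolded fold])
      fix E2 \<D>2 T2
      assume 2: "calm s n E2 \<D>2" "kept E2 \<D>2 ({} \<union> T1 \<union> T2)" "card T2 = N" "\<forall>D\<in>T2. card D = 3"
        "card (singles \<D>1) \<le> card (singles \<D>2) + M"
      show "winning s n d Player_Max E2"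
      proof (rule build_cliques[OF 2(1) s 2(2), of 2 d N, unfolded fold])
        fix E3 \<D>3 T3
        assume 3: "calm s n E3 \<D>3" "kept E3 \<D>3 ({} \<union> T1 \<union> T2 \<union> T3)" "card T3 = N" "\<forall>D\<in>T3. card D = 2"
          "card (singles \<D>2) \<le> card (singles \<D>3) + M"
        have fin: "finite (cliques E3 \<D>3 r)" for r by (rule finite_cliques[OF calmD(2)[OF 3(1)]])
        have sub: "T1 \<subseteq> cliques E3 \<D>3 (s - 4)" "T2 \<subseteq> cliques E3 \<D>3 3" "T3 \<subseteq> cliques E3 \<D>3 2"
          using 1(4) 2(4) 3(2,4) unfolding kept_def cliques_def by auto
        have "supplied s N E3 \<D>3" unfolding supplied_def
          using card_mono[OF fin sub(1)] card_mono[OF fin sub(2)] card_mono[OF fin sub(3)] 1(3) 2(3) 3(3)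
          by auto
        then show "winning s n d Player_Max E3"
          by (intro supplied_wins_Max[OF 3(1) s]) (use k 1(5) 2(5) 3(5) in \<open>auto simp: N_def\<close>)
      qed (use k 1(5) 2(5) s in auto)
    qed (use k 1(5) s in auto)
  qed (use k s in auto)
qed

section \<open>The theorem\<close>

lemma empty_graph_wins:
  assumes s: "7 \<le> s" and n: "4 * d + 6 * s * s * (8 * d + 40) + 7 \<le> n"
  shows "winning s n d first {}"
proof -
  let ?D = "(\<lambda>x. {x}) ` {..<n}"
  have "\<not> contains_path s {}"
    unfolding contains_path_def using s by (auto intro!: exI[of _ 0])
  then have c: "calm s n {} ?D"
    unfolding calm_def valid_def components_partition_def detached_def
    by (auto simp: partition_on_singletons)
  have "singles ?D = ?D" unfolding singles_def by auto
  then have k: "card (singles ?D) = n" by (simp add: card_image)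
  show ?thesis
  proof (cases first)
    case Player_Max
    have "4 * d + 6 * s * s * (8 * d + 40) + 5 \<le> card (singles ?D)" using n k by linarith
    then show ?thesis using calm_wins_Max[OF c s] Player_Max by blast
  next
    case Player_Mini
    \<comment> \<open>When Mini begins, the first move may pair two isolated vertices; the bound on
      \<open>n\<close> exceeds that of \<open>calm_wins_Max\<close> by these two.\<close>
    have "4 * d + 2 \<le> card (singles ?D)" using n k by linarith
    then have "winning s n d Player_Mini {}"
    proof (rule calm_wins_Mini[OF c s])
      fix E' \<D>'
      assume E': "calm s n E' \<D>'" "card (singles ?D) \<le> card (singles \<D>') + 2"
      have "4 * d + 6 * s * s * (8 * d + 40) + 5 \<le> card (singles \<D>')" using E'(2) n k by linarith
      then show "winning s n d Player_Max E'" using calm_wins_Max[OF E'(1) s] by blast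
    qed
    then show ?thesis using Player_Mini by simp
  qed
qed

text \<open>This serves the small \<open>n\<close> of the theorem, where \<open>c * n\<close> is at
  most one: whoever moves first creates a vertex of degree one.\<close>

lemma empty_graph_wins_one:
  assumes s: "7 \<le> s" and n: "2 \<le> n"
  shows "winning s n 1 first {}"
proof -
  have v: "valid s n {}"
    unfolding valid_def contains_path_def using s by (auto intro!: exI[of _ 0])
  have "valid s n (insert {0, 1} {})"
    by (rule valid_insert_within[OF v, of "{0, 1}"]) (use s n in \<open>auto simp: detached_def\<close>)
  then have legal: "{0, 1} \<in> legal_moves s n {}" using legal_moves_iff[OF v, of "{0, 1}"] by simp
  have win: "winning s n 1 p (insert e {})" if "e \<in> legal_moves s n {}" for p e
  proof -
    have "e \<in> complete_edges n" using that unfolding legal_moves_def by blast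
    then obtain a b where ab: "e = {a, b}" "a < n" using complete_edgesE by metis
    have "vertex_degree (insert e {}) a = Suc (vertex_degree {} a)"
      by (rule vertex_degree_insert) (use ab in auto)
    then show ?thesis using winning.goal[of a n 1] ab(2) by simp
  qed
  show ?thesis
  proof (cases first)
    case Player_Max
    then show ?thesis using winning.max_move[OF legal win[OF legal]] by simp
  next
    case Player_Mini
    have "winning s n 1 Player_Mini {}" by (rule winning.mini_move) (use legal win in auto)
    then show ?thesis using Player_Mini by simp
  qed
qed

theorem theorem2p4:
  fixes s :: nat
  assumes "s \<ge> 7"
  shows "\<exists>c::real. c > 0 \<and>
           (\<forall>n::nat. n \<ge> 2 \<longrightarrow>
             (\<forall>first::player. \<exists>\<sigma>. max_strategy s n first \<sigma> \<and>
               (\<forall>h. finished_play s n h \<and> follows first \<sigma> h \<longrightarrow>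
                 (\<exists>v < n. real (vertex_degree (set h) v) \<ge> c * real n))))"
proof -
  \<comment> \<open>For \<open>1 \<le> d\<close> one has \<open>8 * d + 40 \<le> 48 * d\<close> and
    \<open>4 * d + 7 \<le> 11 * d\<close>. As 6 * 48 = 288, \<open>K * d\<close> vertices suffice
    for degree \<open>d\<close>.\<close>
  define K where "K = 288 * s * s + 11"
  define c where "c = 1 / (2 * real K)"
  have K: "0 < K" unfolding K_def by simp
  have "\<exists>\<sigma>. max_strategy s n first \<sigma> \<and>
      (\<forall>h. finished_play s n h \<and> follows first \<sigma> h \<longrightarrow>
        (\<exists>v < n. real (vertex_degree (set h) v) \<ge> c * real n))" if n: "2 \<le> n" for n first
  proof -
    have "\<exists>d. winning s n d first {} \<and> c * real n \<le> real d"
    proof (cases "n < K")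
      case True
      have "c * real n \<le> real 1" unfolding c_def using True K by (simp add: field_simps)
      then show ?thesis using empty_graph_wins_one[OF assms n] by blast
    next
      case False
      define d where "d = n div K"
      have d: "1 \<le> d" using False K unfolding d_def by (simp add: div_greater_zero_iff Suc_leI)
      have Kd: "K * d \<le> n" unfolding d_def by simp
      have "6 * s * s * (8 * d + 40) \<le> 6 * s * s * (48 * d)" using d by (intro mult_left_mono) auto
      then have "4 * d + 6 * s * s * (8 * d + 40) + 7 \<le> K * d"
      proof -
        have "6 * s * s * (48 * d) = 288 * s * s * d" by simp
        moreover have "K * d = 288 * s * s * d + 11 * d" unfolding K_def by (simp add: add_mult_distrib)
        ultimately show ?thesis
          using d \<open>6 * s * s * (8 * d + 40) \<le> 6 * s * s * (48 * d)\<close> by linarith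
      qed
      then have win: "winning s n d first {}" using empty_graph_wins[OF assms] Kd by simp
      \<comment> \<open>Rounding down to \<open>d = n div K\<close> loses less than
        \<open>K\<close>, which is at most \<open>K * d\<close>. This is the reason for the factor 2
        in \<open>c\<close>.\<close>
      have "n < K + K * d" using dividend_less_times_div[OF K, of n] unfolding d_def by simp
      moreover have "K * 1 \<le> K * d" using d by (rule mult_le_mono2)
      ultimately have "n \<le> 2 * (K * d)" by linarith
      then have "real n \<le> real (2 * (K * d))" by (simp only: of_nat_le_iff)
      then have "real n \<le> 2 * real K * real d" by simp
      then have "c * real n \<le> real d" unfolding c_def using K by (simp add: field_simps)
      then show ?thesis using win by blast
    qed
    then obtain d where d: "winning s n d first {}" "c * real n \<le> real d" by blast
    obtain \<sigma> where \<sigma>: "max_strategy s n first \<sigma>"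
      "\<And>h. finished_play s n h \<Longrightarrow> follows first \<sigma> h \<Longrightarrow> \<exists>v<n. d \<le> vertex_degree (set h) v"
      using winning_strategy[OF d(1)] by blast
    have "\<exists>v<n. c * real n \<le> real (vertex_degree (set h) v)"
      if "finished_play s n h" "follows first \<sigma> h" for h
      using \<sigma>(2)[OF that] d(2) order_trans of_nat_le_iff by (metis (mono_tags, lifting))
    then show ?thesis using \<sigma>(1) by blast
  qed
  then show ?thesis using K unfolding c_def by (intro exI[of _ "1 / (2 * real K)"]) auto
qed

end
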